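(* Let $X_1,X_2$ be uniformly nonsquare Banach spaces and let $\|\cdot\|_\psi$ be any absolute normalized norm on $\mathbb{R}^2$. Then the direct sum $X_1\oplus_\psi X_2$ has the fixed point property.
   Context: A Banach space $X$ is uniformly nonsquare if $\sup_{x,y\in S_X}\min\{\|x+y\|,\|x-y\|\}<2$. A norm on $\mathbb{R}^2$ is absolute if $\|(x_1,x_2)\|=\|(|x_1|,|x_2|)\|$ and normalized if $\|(1,0)\|=\|(0,1)\|=1$ (equivalently, monotone and normalized). $X_1\oplus_\psi X_2$ is $X_1\times X_2$ with norm $\|(x_1,x_2)\|_\psi=\|(\|x_1\|,\|x_2\|)\|_\psi$. Fixed point property: every nonexpansive mapping $T:C\to C$ on a nonempty bounded closed convex subset $C$ has a fixed point. *)

theory Defs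
  imports "HOL-Analysis.Analysis"
begin

definition uniformly_nonsquare :: "('a::real_normed_vector) itself \<Rightarrow> bool" where
  "uniformly_nonsquare _ \<longleftrightarrow>
     (\<exists>c<2. \<forall>x y::'a. norm x = 1 \<longrightarrow> norm y = 1 \<longrightarrow> min (norm (x + y)) (norm (x - y)) \<le> c)"

definition is_norm_R2 :: "(real \<times> real \<Rightarrow> real) \<Rightarrow> bool" where
  "is_norm_R2 \<psi> \<longleftrightarrow>
     (\<forall>z. 0 \<le> \<psi> z) \<and> (\<forall>z. \<psi> z = 0 \<longleftrightarrow> z = (0,0)) \<and>
     (\<forall>t a b. \<psi> (t * a, t * b) = \<bar>t\<bar> * \<psi> (a, b)) \<and>
     (\<forall>a b c d. \<psi> (a + c, b + d) \<le> \<psi> (a, b) + \<psi> (c, d))"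

definition absolute_normalized_norm :: "(real \<times> real \<Rightarrow> real) \<Rightarrow> bool" where
  "absolute_normalized_norm \<psi> \<longleftrightarrow> is_norm_R2 \<psi> \<and>
     (\<forall>a b. \<psi> (a, b) = \<psi> (\<bar>a\<bar>, \<bar>b\<bar>)) \<and> \<psi> (1, 0) = 1 \<and> \<psi> (0, 1) = 1"

definition psi_sum_norm :: "(real \<times> real \<Rightarrow> real) \<Rightarrow> ('a::real_normed_vector) \<times> ('b::real_normed_vector) \<Rightarrow> real" where
  "psi_sum_norm \<psi> p = \<psi> (norm (fst p), norm (snd p))"

definition fixed_point_property :: "('v::real_vector \<Rightarrow> real) \<Rightarrow> bool" where
  "fixed_point_property N \<longleftrightarrow>
     (\<forall>C T. C \<noteq> {} \<and> convex C \<and>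
        (\<exists>M. \<forall>x\<in>C. N x \<le> M) \<and>
        (\<forall>s x. (\<forall>n. s n \<in> C) \<and> ((\<lambda>n. N (s n - x)) \<longlonglongrightarrow> 0) \<longrightarrow> x \<in> C) \<and>
        T ` C \<subseteq> C \<and> (\<forall>x\<in>C. \<forall>y\<in>C. N (T x - T y) \<le> N (x - y))
      \<longrightarrow> (\<exists>x\<in>C. T x = x))"

end

theory Submission
  imports Defs
begin

text \<open>Uniformly nonsquare spaces are reflexive (James), so a nonexpansive map without fixed point has
  a minimal invariant set \<open>K\<close> of diameter \<open>d > 0\<close>. Let \<open>x\<^sub>n\<close> be approximate fixed points in \<open>K\<close>
  with weak limit \<open>w\<close>. For \<open>0 < s < d\<close> there are further approximate fixed points \<open>z\<^sub>n\<close>, close to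
  \<open>w + (s / d) (x\<^sub>n - w)\<close> in the sense that \<open>\<parallel>z\<^sub>n - z\<^sub>m\<parallel> \<le> s\<close> and \<open>\<parallel>z\<^sub>n - x\<^sub>n\<parallel> \<le> d - s\<close>
  asymptotically, while \<open>\<parallel>z\<^sub>n - w\<parallel>\<close> is almost \<open>d\<close> by Goebel and Karlovitz. If \<open>v\<close> is a weak limit
  of \<open>z\<^sub>n\<close>, then \<open>z\<^sub>n - w\<close> splits into \<open>v - w\<close> of norm at most \<open>d - s\<close> and the weakly null
  \<open>z\<^sub>n - v\<close> of norm at most \<open>s\<close>, with no loss in the triangle inequality. Nonsquareness prevents a
  single coordinate from carrying both parts, so that each coordinate carries exactly one, and then the
  coordinate of \<open>x\<^sub>n - w\<close> carrying the second part has asymptotic norm \<open>s\<close>. But only two values of \<open>s\<close>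
  are possible.\<close>

section \<open>Maximal families and ultrafilters\<close>

text \<open>The sum of two nonzero spaces under the sum norm or the maximum norm is never uniformly
  nonsquare, so nonsquareness must be used in each coordinate. There it reads \<open>\<delta> \<le>
  \<alpha> + \<gamma> - \<kappa> * min \<alpha> \<gamma>\<close>, where \<open>\<delta>\<close> is
  the asymptotic norm of \<open>z n - w\<close>, \<open>\<alpha>\<close> the norm of
  \<open>v - w\<close>, and \<open>\<gamma>\<close> the iterated limit of the mutual distances of
  the \<open>z n\<close>, which stands in for the norm of \<open>z n - v\<close>. A supporting
  functional of \<open>\<psi>\<close> at \<open>(\<delta>1, \<delta>2)\<close> merges the two
  coordinates into one scalar balance. The asymptotic coordinate norms \<open>a1\<close>,
  \<open>a2\<close> of \<open>x n - w\<close> are known before \<open>s\<close> is chosen, so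
  \<open>s\<close> can avoid both; the admissible error is fixed last. Reflexivity is proved inside
  the space. A maximal family of closed convex sets with the finite intersection property plays the
  bidual element, and its maximality replaces separation by functionals. Outside the space such an
  element would make the norms of oscillating combinations grow geometrically, against a linear
  bound.\<close>

definition fip :: "'a set set \<Rightarrow> bool" where
  "fip \<F> \<longleftrightarrow> (\<forall>\<G>\<subseteq>\<F>. finite \<G> \<longrightarrow> \<Inter>\<G> \<noteq> {})"

text \<open>Zorn's lemma applies because a finite subfamily of the union of a chain lies in one
  member. The ambient collection \<open>\<D>\<close> is a parameter: all sets give ultrafilters,
  closed convex sets give the bidual element in James's theorem.\<close>

lemma fip_extend_maximal:
  assumes "\<C> \<subseteq> \<D>" "fip \<C>"
  obtains \<F> where "\<C> \<subseteq> \<F>" "\<F> \<subseteq> \<D>" "fip \<F>"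
    "\<And>D. D \<in> \<D> \<Longrightarrow> D \<notin> \<F> \<Longrightarrow> \<exists>\<G>\<subseteq>\<F>. finite \<G> \<and> D \<inter> \<Inter>\<G> = {}"
proof -
  let ?A = "{\<F>. \<C> \<subseteq> \<F> \<and> \<F> \<subseteq> \<D> \<and> fip \<F>}"
  have "\<exists>M\<in>?A. \<forall>X\<in>?A. M \<subseteq> X \<longrightarrow> X = M"
  proof (rule subset_Zorn_nonempty)
    show "?A \<noteq> {}" using assms by auto
    fix \<X> assume ne: "\<X> \<noteq> {}" and ch: "subset.chain ?A \<X>"
    have "\<Inter>\<G> \<noteq> {}" if G: "\<G> \<subseteq> \<Union>\<X>" "finite \<G>" for \<G>
    proof -
      obtain X where "X \<in> \<X>" "\<G> \<subseteq> X"
        using finite_subset_Union_chain[OF G(2,1) ne ch] by blast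
      then show ?thesis
        using ch G(2) by (auto simp: subset.chain_def fip_def)
    qed
    then have "fip (\<Union>\<X>)" by (simp add: fip_def)
    then show "\<Union>\<X> \<in> ?A" using ne ch by (auto simp: subset.chain_def)
  qed
  then obtain \<F> where F: "\<C> \<subseteq> \<F>" "\<F> \<subseteq> \<D>" "fip \<F>"
    and "\<forall>X\<in>?A. \<F> \<subseteq> X \<longrightarrow> X = \<F>" by auto
  then have max: "\<X> = \<F>" if "\<F> \<subseteq> \<X>" "\<X> \<subseteq> \<D>" "fip \<X>" for \<X>
    using that by (metis (mono_tags, lifting) mem_Collect_eq order_trans)
  have "\<exists>\<G>\<subseteq>\<F>. finite \<G> \<and> D \<inter> \<Inter>\<G> = {}" if D: "D \<in> \<D>" "D \<notin> \<F>" for D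
  proof -
    have "insert D \<F> \<subseteq> \<D>" "insert D \<F> \<noteq> \<F>" using D F(2) by auto
    then have "\<not> fip (insert D \<F>)" using max[of "insert D \<F>"] by blast
    then obtain \<H> where H: "\<H> \<subseteq> insert D \<F>" "finite \<H>" "\<Inter>\<H> = {}"
      unfolding fip_def by blast
    have "D \<inter> \<Inter>(\<H> - {D}) \<subseteq> \<Inter>\<H>" by auto
    then have "\<H> - {D} \<subseteq> \<F> \<and> finite (\<H> - {D}) \<and> D \<inter> \<Inter>(\<H> - {D}) = {}"
      using H by auto
    then show ?thesis by blast
  qed
  with F show thesis by (rule that)
qed

definition fip_filter :: "'a set set \<Rightarrow> 'a filter" where
  "fip_filter \<F> = (INF C\<in>\<F>. principal C)"

lemma eventually_fip_filterI: "C \<in> \<F> \<Longrightarrow> eventually (\<lambda>x. x \<in> C) (fip_filter \<F>)"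
  unfolding fip_filter_def by (rule eventually_INF1) (auto simp: eventually_principal)

lemma fip_filter_neq_bot:
  assumes "fip \<F>"
  shows "fip_filter \<F> \<noteq> bot"
proof -
  have "(INF C\<in>X. principal C) \<noteq> bot" if "X \<subseteq> \<F>" "finite X" for X
  proof -
    have "(INF C\<in>X. principal C) = principal (\<Inter>X)"
      using INF_principal_finite[OF that(2), of "\<lambda>x. x"] by simp
    then show ?thesis using assms that by (auto simp: fip_def principal_eq_bot_iff)
  qed
  then show ?thesis
    unfolding fip_filter_def trivial_limit_def
    by (subst eventually_INF) (auto simp: trivial_limit_def)
qed

definition ultra :: "'a filter \<Rightarrow> bool" where
  "ultra U \<longleftrightarrow> U \<noteq> bot \<and> (\<forall>P. eventually P U \<or> eventually (\<lambda>x. \<not> P x) U)"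

text \<open>In a maximal family among all sets, a set outside is disjoint from a finite intersection
  of members, so the filter contains its complement.\<close>

lemma ultra_exists:
  assumes "F \<noteq> bot"
  obtains U where "U \<le> F" "ultra U"
proof -
  let ?C = "{S. eventually (\<lambda>x. x \<in> S) F}"
  have "fip ?C"
    unfolding fip_def
  proof (intro allI impI)
    fix \<G> assume "\<G> \<subseteq> ?C" "finite \<G>"
    then have "eventually (\<lambda>x. \<forall>S\<in>\<G>. x \<in> S) F" by (intro eventually_ball_finite) auto
    then show "\<Inter>\<G> \<noteq> {}" using assms eventually_happens' by fastforce
  qed
  then obtain \<F> where \<F>: "?C \<subseteq> \<F>" "fip \<F>"
    and max: "\<And>D. D \<notin> \<F> \<Longrightarrow> \<exists>\<G>\<subseteq>\<F>. finite \<G> \<and> D \<inter> \<Inter>\<G> = {}"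
    using fip_extend_maximal[of ?C UNIV] by (metis UNIV_I subset_UNIV)
  show thesis
  proof
    show "fip_filter \<F> \<le> F"
      unfolding le_filter_def
    proof (intro allI impI)
      fix P assume "eventually P F"
      then show "eventually P (fip_filter \<F>)"
        using eventually_fip_filterI[of "{x. P x}" \<F>] \<F>(1) subsetD[OF \<F>(1), of "{x. P x}"] by simp
    qed
    show "ultra (fip_filter \<F>)"
      unfolding ultra_def
    proof (intro conjI allI fip_filter_neq_bot \<F>(2))
      fix P
      show "eventually P (fip_filter \<F>) \<or> eventually (\<lambda>x. \<not> P x) (fip_filter \<F>)"
      proof (cases "{x. P x} \<in> \<F>")
        case True
        then show ?thesis using eventually_fip_filterI by fastforce
      next
        case False
        then obtain \<G> where G: "\<G> \<subseteq> \<F>" "finite \<G>" "{x. P x} \<inter> \<Inter>\<G> = {}" by (metis max)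
        have "\<forall>S\<in>\<G>. eventually (\<lambda>x. x \<in> S) (fip_filter \<F>)"
          using G(1) by (metis eventually_fip_filterI subsetD)
        then have "eventually (\<lambda>x. \<forall>S\<in>\<G>. x \<in> S) (fip_filter \<F>)"
          using G(2) by (rule eventually_ball_finite[rotated])
        then show ?thesis by (intro disjI2) (erule eventually_mono, use G in auto)
      qed
    qed
  qed
qed

text \<open>Compactness of \<open>{-B..B}\<close> gives a cluster point, and along an ultrafilter a
  cluster point is a limit. Thus every bounded quantity has a limit and no subsequences are
  needed.\<close>

lemma ultra_tendsto_Lim:
  fixes f :: "'a \<Rightarrow> real"
  assumes U: "ultra U" and B: "eventually (\<lambda>x. \<bar>f x\<bar> \<le> B) U"
  shows "(f \<longlongrightarrow> Lim U f) U"
proof -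
  have nb: "U \<noteq> bot" using U by (simp add: ultra_def)
  have "eventually (\<lambda>y. y \<in> {-B..B}) (filtermap f U)"
    using B by (auto simp: eventually_filtermap abs_le_iff elim!: eventually_mono)
  then obtain l where l: "inf (nhds l) (filtermap f U) \<noteq> bot"
    using compact_Icc[of "-B" B] nb unfolding compact_filter
    by (metis filtermap_bot_iff)
  have "(f \<longlongrightarrow> l) U"
  proof (rule topological_tendstoI)
    fix S assume S: "open S" "l \<in> S"
    have "\<not> eventually (\<lambda>x. f x \<notin> S) U"
    proof
      assume "eventually (\<lambda>x. f x \<notin> S) U"
      then have "eventually (\<lambda>y. y \<notin> S) (filtermap f U)" by (simp add: eventually_filtermap)
      moreover have "eventually (\<lambda>y. y \<in> S) (nhds l)" using S eventually_nhds by blast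
      ultimately have "eventually (\<lambda>_. False) (inf (nhds l) (filtermap f U))"
        unfolding eventually_inf by blast
      then show False using l trivial_limit_def by blast
    qed
    then show "eventually (\<lambda>x. f x \<in> S) U" using U unfolding ultra_def by blast
  qed
  then show ?thesis using tendsto_Lim nb by blast
qed

section \<open>Uniformly nonsquare spaces are reflexive\<close>

text \<open>For Banach spaces this is reflexivity (Smulian); the formulation avoids the dual space.\<close>

definition convex_compact :: "'a::real_normed_vector itself \<Rightarrow> bool" where
  "convex_compact _ \<longleftrightarrow> (\<forall>\<C>::'a set set. fip \<C> \<longrightarrow> (\<forall>C\<in>\<C>. closed C \<and> convex C) \<longrightarrow>
     (\<exists>C\<in>\<C>. bounded C) \<longrightarrow> \<Inter>\<C> \<noteq> {})"

text \<open>The longer vector is cut into a piece as long as the shorter one and a remainder in the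
  same direction. Nonsquareness applies to the two pieces of equal length; the remainder costs only
  its own length.\<close>

lemma uniformly_nonsquareE:
  assumes "uniformly_nonsquare TYPE('a::real_normed_vector)"
  obtains \<kappa> where "0 < \<kappa>" "\<kappa> \<le> 1"
    "\<And>x y::'a. min (norm (x + y)) (norm (x - y)) \<le> norm x + norm y - \<kappa> * min (norm x) (norm y)"
proof -
  obtain c where c: "c < 2"
    "\<And>x y::'a. norm x = 1 \<Longrightarrow> norm y = 1 \<Longrightarrow> min (norm (x + y)) (norm (x - y)) \<le> c"
    using assms by (auto simp: uniformly_nonsquare_def)
  \<comment> \<open>The cap at 1 keeps the ratio \<open>1 - \<kappa> / 2\<close> of the later growth
    argument positive.\<close>
  define \<kappa> where "\<kappa> = min 1 (2 - c)"
  have k: "0 < \<kappa>" "\<kappa> \<le> 1" "c \<le> 2 - \<kappa>" using c(1) by (auto simp: \<kappa>_def)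
  have *: "min (norm (x + y)) (norm (x - y)) \<le> norm x + norm y - \<kappa> * norm y"
    if le: "norm y \<le> norm x" for x y :: 'a
  proof (cases "y = 0")
    case False
    then have pos: "norm y > 0" "norm x > 0" using le by auto
    define x' y' where "x' = x /\<^sub>R norm x" and "y' = y /\<^sub>R norm y"
    have n: "norm x' = 1" "norm y' = 1" and y: "y = norm y *\<^sub>R y'"
      using pos by (auto simp: x'_def y'_def)
    have x: "x = (norm x - norm y) *\<^sub>R x' + norm y *\<^sub>R x'"
    proof -
      have "(norm x - norm y) *\<^sub>R x' + norm y *\<^sub>R x' = norm x *\<^sub>R x'"
        by (simp flip: scaleR_left.add)
      then show ?thesis using pos by (simp add: x'_def)
    qed
    have p: "norm (x + y) \<le> (norm x - norm y) + norm y * norm (x' + y')"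
    proof -
      have "x + y = (norm x - norm y) *\<^sub>R x' + norm y *\<^sub>R (x' + y')"
        by (subst x, subst y) (simp only: scaleR_add_right add.assoc)
      then have "norm (x + y) \<le> norm ((norm x - norm y) *\<^sub>R x') + norm (norm y *\<^sub>R (x' + y'))"
        by (metis norm_triangle_ineq)
      then show ?thesis using le n by simp
    qed
    have m: "norm (x - y) \<le> (norm x - norm y) + norm y * norm (x' - y')"
    proof -
      have "x - y = (norm x - norm y) *\<^sub>R x' + norm y *\<^sub>R (x' - y')"
        by (subst x, subst y) (simp only: scaleR_diff_right add_diff_eq)
      then have "norm (x - y) \<le> norm ((norm x - norm y) *\<^sub>R x') + norm (norm y *\<^sub>R (x' - y'))"
        by (metis norm_triangle_ineq)
      then show ?thesis using le n by simp
    qed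
    have "norm (x' + y') \<le> 2 - \<kappa> \<or> norm (x' - y') \<le> 2 - \<kappa>"
      using c(2)[OF n] k(3) by auto
    then have "norm y * norm (x' + y') \<le> norm y * (2 - \<kappa>) \<or> norm y * norm (x' - y')
      \<le> norm y * (2 - \<kappa>)"
      using pos by (meson mult_left_mono less_imp_le)
    then show ?thesis using p m by (auto simp: algebra_simps min_le_iff_disj)
  qed auto
  show thesis
  proof (rule that[OF k(1,2)])
    fix x y :: 'a
    show "min (norm (x + y)) (norm (x - y)) \<le> norm x + norm y - \<kappa> * min (norm x) (norm y)"
    proof (cases "norm y \<le> norm x")
      case True
      then show ?thesis using *[of y x] by (simp add: min_absorb2)
    next
      case False
      then show ?thesis using *[of x y] by (simp add: min_absorb1 add.commute norm_minus_commute)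
    qed
  qed
qed

text \<open>A filter \<open>U\<close> represents a bidual element \<open>F\<close>, and \<open>iter_lim U [a\<^sub>1, \<dots>, a\<^sub>n] y\<close> is the norm of
  \<open>y + a\<^sub>1 F\<^sub>1 + \<dots> + a\<^sub>n F\<^sub>n\<close>, where the \<open>F\<^sub>i\<close> are the copies of \<open>F\<close> in the successive even duals.\<close>

primrec iter_lim :: "'a::real_normed_vector filter \<Rightarrow> real list \<Rightarrow> 'a \<Rightarrow> real" where
  "iter_lim U [] y = norm y"
| "iter_lim U (a # as) y = Lim U (\<lambda>x. iter_lim U as (y + a *\<^sub>R x))"

text \<open>The tail sums are \<open>\<sigma>\<close>, \<open>-\<sigma>\<close>, \<open>\<sigma>\<close>, \<open>\<dots>\<close> at \<open>n\<close> increasing positions.\<close>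

primrec alternating :: "nat \<Rightarrow> real \<Rightarrow> real list \<Rightarrow> bool" where
  "alternating 0 \<sigma> as \<longleftrightarrow> True"
| "alternating (Suc n) \<sigma> as \<longleftrightarrow>
     (\<exists>bs cs. as = bs @ cs \<and> sum_list cs = \<sigma> \<and> alternating n (- \<sigma>) cs)"

lemma alternating_append: "alternating n \<sigma> as \<Longrightarrow> alternating n \<sigma> (bs @ as)"
  by (cases n) (simp, metis alternating.simps(2) append.assoc)

lemma alternating_Suc: "alternating (Suc n) \<sigma> as \<Longrightarrow> alternating n \<sigma> as"
proof (induction n arbitrary: \<sigma> as)
  case (Suc n)
  then obtain bs cs where "as = bs @ cs" "sum_list cs = \<sigma>" "alternating (Suc n) (- \<sigma>) cs"
    unfolding alternating.simps(2)[of "Suc n"] by blast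
  then show ?case using Suc.IH[of "- \<sigma>" cs] unfolding alternating.simps(2)[of n \<sigma>] by blast
qed simp

lemma alternating_scale: "alternating n \<sigma> as \<Longrightarrow> alternating n (c * \<sigma>) (map ((*) c) as)"
proof (induction n arbitrary: \<sigma> as)
  case (Suc n)
  then obtain bs cs where "as = bs @ cs" "sum_list cs = \<sigma>" "alternating n (- \<sigma>) cs"
    by auto
  then show ?case using Suc.IH[of "- \<sigma>" cs]
    unfolding alternating.simps
    by (intro exI[of _ "map ((*) c) bs"] exI[of _ "map ((*) c) cs"])
      (auto simp: sum_list_const_mult)
qed simp

definition half_sum :: "real list \<Rightarrow> real list \<Rightarrow> real list" where
  "half_sum u v = map2 (\<lambda>a b. (a + b) / 2) u v"

definition half_diff :: "real list \<Rightarrow> real list \<Rightarrow> real list" where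
  "half_diff u v = map2 (\<lambda>a b. (a - b) / 2) u v"

lemma half_append:
  assumes "length u = length v"
  shows "half_sum (u @ u') (v @ v') = half_sum u v @ half_sum u' v'"
    and "half_diff (u @ u') (v @ v') = half_diff u v @ half_diff u' v'"
  using assms by (simp_all add: half_sum_def half_diff_def)

lemma sum_list_half:
  assumes "length u = length v"
  shows "sum_list (half_sum u v) = (sum_list u + sum_list v) / 2"
    and "sum_list (half_diff u v) = (sum_list u - sum_list v) / 2"
  using assms by (induction u v rule: list_induct2)
    (auto simp: half_sum_def half_diff_def field_simps)

section \<open>James's growth argument\<close>

text \<open>The situation forced by a failure of convex compactness, which the locale refutes.
  \<open>separate\<close> is the trace of maximality and takes the place of a separation theorem;
  \<open>far\<close> says that the bidual element given by \<open>U\<close> has distance at least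
  \<open>\<rho>\<close> from the space.\<close>

locale james =
  fixes U :: "'a::real_normed_vector filter" and M \<rho> \<kappa> :: real
  assumes ultra: "ultra U" and bounded: "eventually (\<lambda>x. norm x \<le> M) U"
    and separate: "\<And>D. closed D \<Longrightarrow> convex D \<Longrightarrow>
      eventually (\<lambda>x. x \<in> D) U \<or> (\<exists>C. convex C \<and> C \<inter> D = {} \<and> eventually (\<lambda>x. x \<in> C) U)"
    and far: "0 < \<rho>" "\<And>w. eventually (\<lambda>x. \<rho> \<le> norm (x - w)) U"
    and nonsquare: "0 < \<kappa>" "\<kappa> \<le> 1"
      "\<And>x y::'a. min (norm (x + y)) (norm (x - y)) \<le> norm x + norm y - \<kappa> * min (norm x) (norm y)"
begin

abbreviation J :: "real list \<Rightarrow> 'a \<Rightarrow> real" where "J \<equiv> iter_lim U"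

lemma nontriv: "U \<noteq> bot"
  using ultra by (simp add: ultra_def)

lemma M_nonneg: "0 \<le> M"
proof -
  obtain x :: 'a where "norm x \<le> M" using eventually_happens'[OF nontriv bounded] by auto
  then show ?thesis using norm_ge_zero order_trans by blast
qed

text \<open>The claims need a joint induction: the limit defining the next level exists because the
  current level is bounded, and the bound passes on through that limit.\<close>

lemma J_tendsto_bound:
  "((\<lambda>x. J as (y + a *\<^sub>R x)) \<longlongrightarrow> J (a # as) y) U \<and> 0 \<le> J as y \<and> J as y \<le> norm y + M * (\<Sum>a\<leftarrow>as. \<bar>a\<bar>)"
proof (induction as arbitrary: a y)
  case Nil
  have "eventually (\<lambda>x. \<bar>norm (y + a *\<^sub>R x)\<bar> \<le> norm y + \<bar>a\<bar> * M) U"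
    using bounded
  proof eventually_elim
    case (elim x)
    have "norm (y + a *\<^sub>R x) \<le> norm y + \<bar>a\<bar> * norm x" by (metis norm_scaleR norm_triangle_ineq)
    also have "\<dots> \<le> norm y + \<bar>a\<bar> * M" using elim by (simp add: mult_left_mono)
    finally show ?case by simp
  qed
  then show ?case using ultra_tendsto_Lim[OF ultra] by simp
next
  case (Cons b as)
  have lim: "((\<lambda>x. J as (z + b *\<^sub>R x)) \<longlongrightarrow> J (b # as) z) U" for z using Cons by blast
  have bnd: "0 \<le> J as z" "J as z \<le> norm z + M * (\<Sum>a\<leftarrow>as. \<bar>a\<bar>)" for z using Cons by blast+
  have ge: "0 \<le> J (b # as) z" for z
    using tendsto_lowerbound[OF lim always_eventually nontriv] bnd by blast
  have le: "J (b # as) z \<le> norm z + M * (\<Sum>a\<leftarrow>b # as. \<bar>a\<bar>)" for z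
  proof (rule tendsto_upperbound[OF lim _ nontriv])
    show "\<forall>\<^sub>F x in U. J as (z + b *\<^sub>R x) \<le> norm z + M * (\<Sum>a\<leftarrow>b # as. \<bar>a\<bar>)"
      using bounded
    proof eventually_elim
      case (elim x)
      have "norm (z + b *\<^sub>R x) \<le> norm z + \<bar>b\<bar> * norm x" by (metis norm_scaleR norm_triangle_ineq)
      also have "\<dots> \<le> norm z + M * \<bar>b\<bar>"
        using elim by (simp add: mult_right_mono mult.commute[of "\<bar>b\<bar>"])
      finally show ?case using bnd(2)[of "z + b *\<^sub>R x"] by (simp add: algebra_simps)
    qed
  qed
  have "eventually (\<lambda>x. \<bar>J (b # as) (y + a *\<^sub>R x)\<bar> \<le> norm y + \<bar>a\<bar> * M + M * (\<Sum>a\<leftarrow>b # as. \<bar>a\<bar>)) U"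
    using bounded
  proof eventually_elim
    case (elim x)
    have "norm (y + a *\<^sub>R x) \<le> norm y + \<bar>a\<bar> * norm x" by (metis norm_scaleR norm_triangle_ineq)
    also have "\<dots> \<le> norm y + \<bar>a\<bar> * M" using elim by (simp add: mult_left_mono)
    finally show ?case using le[of "y + a *\<^sub>R x"] ge[of "y + a *\<^sub>R x"] by linarith
  qed
  then have "((\<lambda>x. J (b # as) (y + a *\<^sub>R x)) \<longlongrightarrow> J (a # b # as) y) U"
    unfolding iter_lim.simps(2)[of U a "b # as"] by (rule ultra_tendsto_Lim[OF ultra])
  then show ?case using ge le by blast
qed

lemma J_tendsto: "((\<lambda>x. J as (y + a *\<^sub>R x)) \<longlongrightarrow> J (a # as) y) U"
  and J_nonneg: "0 \<le> J as y"
  and J_le: "J as y \<le> norm y + M * (\<Sum>a\<leftarrow>as. \<bar>a\<bar>)"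
  using J_tendsto_bound by blast+

declare iter_lim.simps(2) [simp del]

lemma J_Cons_0 [simp]: "J (0 # as) y = J as y"
  using tendsto_unique[OF nontriv J_tendsto[of as y 0]] by (simp add: tendsto_const)

lemma J_zeros [simp]: "J (replicate k 0 @ as) y = J as y"
  by (induction k) auto

lemma J_scale: "J (map ((*) c) as) (c *\<^sub>R y) = \<bar>c\<bar> * J as y"
proof (induction as arbitrary: y)
  case (Cons a as)
  have "((\<lambda>x. J (map ((*) c) as) (c *\<^sub>R y + (c * a) *\<^sub>R x)) \<longlongrightarrow> J (map ((*) c) (a # as)) (c *\<^sub>R y)) U"
    using J_tendsto by simp
  moreover have "c *\<^sub>R y + (c * a) *\<^sub>R x = c *\<^sub>R (y + a *\<^sub>R x)" for x
    by (simp add: scaleR_add_right)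
  ultimately have "((\<lambda>x. \<bar>c\<bar> * J as (y + a *\<^sub>R x)) \<longlongrightarrow> J (map ((*) c) (a # as)) (c *\<^sub>R y)) U"
    by (simp add: Cons)
  moreover have "((\<lambda>x. \<bar>c\<bar> * J as (y + a *\<^sub>R x)) \<longlongrightarrow> \<bar>c\<bar> * J (a # as) y) U"
    by (intro tendsto_intros J_tendsto)
  ultimately show ?case using tendsto_unique[OF nontriv] by blast
qed simp

lemma J_append_cong: "(\<And>z. J as z = J bs z) \<Longrightarrow> J (cs @ as) y = J (cs @ bs) y"
  by (induction cs arbitrary: y) (simp_all add: iter_lim.simps(2))

lemma J_append_ge:
  assumes "\<And>z. c \<le> J as z"
  shows "c \<le> J (bs @ as) y"
  using assms
proof (induction bs arbitrary: y)
  case (Cons b bs)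
  have "c \<le> J (b # bs @ as) y"
    by (rule tendsto_lowerbound[OF J_tendsto always_eventually nontriv]) (use Cons in blast)
  then show ?case by simp
qed simp

text \<open>At each position both lists use the same variable \<open>x\<close>, so the coefficients
  add position by position. Both sides depend continuously on the inner values, hence the inequality
  of the space survives every limit.\<close>

lemma J_nonsquare:
  assumes "length u = length v"
  shows "min (J (map2 (+) u v) (y + z)) (J (map2 (-) u v) (y - z))
    \<le> J u y + J v z - \<kappa> * min (J u y) (J v z)"
  using assms
proof (induction u v arbitrary: y z rule: list_induct2)
  case Nil
  then show ?case using nonsquare(3)[of y z] by simp
next
  case (Cons a u b v)
  let ?f = "\<lambda>x. min (J (map2 (+) u v) ((y + z) + (a + b) *\<^sub>R x)) (J (map2 (-) u v) ((y - z) + (a - b) *\<^sub>R x))"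
  let ?g = "\<lambda>x. J u (y + a *\<^sub>R x) + J v (z + b *\<^sub>R x) - \<kappa> * min (J u (y + a *\<^sub>R x)) (J v (z + b *\<^sub>R x))"
  have "(?f \<longlongrightarrow> min (J (map2 (+) (a # u) (b # v)) (y + z)) (J (map2 (-) (a # u) (b # v)) (y - z))) U"
    using J_tendsto by (auto intro!: tendsto_min)
  moreover have "(?g \<longlongrightarrow> J (a # u) y + J (b # v) z - \<kappa> * min (J (a # u) y) (J (b # v) z)) U"
    by (intro tendsto_intros tendsto_min J_tendsto)
  moreover have "?f x \<le> ?g x" for x
    using Cons.IH[of "y + a *\<^sub>R x" "z + b *\<^sub>R x"] by (simp add: algebra_simps)
  ultimately show ?case using tendsto_le[OF nontriv] always_eventually by blast
qed

lemma J_half: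
  assumes "length u = length v"
  shows "min (J (half_sum u v) 0) (J (half_diff u v) 0)
    \<le> (J u 0 + J v 0 - \<kappa> * min (J u 0) (J v 0)) / 2"
proof -
  have "half_sum u v = map ((*) (1/2)) (map2 (+) u v)"
    "half_diff u v = map ((*) (1/2)) (map2 (-) u v)"
    by (auto simp: half_sum_def half_diff_def)
  then have "J (half_sum u v) 0 = J (map2 (+) u v) 0 / 2"
    "J (half_diff u v) 0 = J (map2 (-) u v) 0 / 2"
    using J_scale[of "1/2" "map2 (+) u v" 0] J_scale[of "1/2" "map2 (-) u v" 0]
      by (simp_all only:) simp_all
  then show ?thesis using J_nonsquare[OF assms, of 0 0] by (auto simp: min_def split: if_splits)
qed

text \<open>Both \<open>u\<close> and \<open>v\<close> arise from \<open>as\<close> by inserting zeros, such that their nonzero blocks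
  interlace. Tail sums of the half difference are taken between the two copies of a block, which costs
  only one alternation.\<close>

lemma spread_exists:
  assumes "alternating n \<sigma> as"
  shows "\<exists>u v. length u = length v \<and> (\<forall>y. J u y = J as y) \<and> (\<forall>y. J v y = J as y) \<and>
    sum_list u = sum_list as \<and> sum_list v = sum_list as \<and>
    alternating n \<sigma> (half_sum u v) \<and> (sum_list as = - \<sigma> \<longrightarrow> alternating n \<sigma> (half_diff u v)) \<and>
    alternating (n - 1) (- \<sigma>) (half_diff u v)"
  using assms
proof (induction n arbitrary: \<sigma> as)
  case 0
  let ?z = "replicate (length as) (0::real)"
  have "J (as @ ?z) y = J as y" for y
    using J_append_cong[of ?z "[]" as y] J_zeros[of _ "[]"] by simp
  then show ?case
    by (intro exI[of _ "as @ ?z"] exI[of _ "?z @ as"]) (auto simp: sum_list_replicate)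
next
  case (Suc n)
  then obtain b cs where as: "as = b @ cs" "sum_list cs = \<sigma>" and alt: "alternating n (- \<sigma>) cs"
    by auto
  \<comment> \<open>The tail \<open>cs\<close> has sum \<open>\<sigma>\<close>, the negative of its
    own sign \<open>- \<sigma>\<close>. Hence the conditional claim on half differences applies to
    it, and an alternation can be lost only at the outermost level.\<close>
  obtain u v where uv: "length u = length v" "\<And>y. J u y = J cs y" "\<And>y. J v y = J cs y"
    "sum_list u = \<sigma>" "sum_list v = \<sigma>" "alternating n (- \<sigma>) (half_sum u v)"
    "alternating n (- \<sigma>) (half_diff u v)"
    using Suc.IH[OF alt] as(2) by auto
  let ?z = "replicate (length b) (0::real)"
  let ?u = "b @ ?z @ u" and ?v = "?z @ b @ v"
  have hs: "half_sum ?u ?v = (half_sum b ?z @ half_sum ?z b) @ half_sum u v"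
    by (simp add: half_append)
  have hd: "half_diff ?u ?v = half_diff b ?z @ (half_diff ?z b @ half_diff u v)"
    by (simp add: half_append)
  \<comment> \<open>The half difference is cut between the two copies of \<open>b\<close>. If
    \<open>sum_list as = - \<sigma>\<close>, then \<open>b\<close> has sum
    \<open>- 2 * \<sigma>\<close> and the tail after the cut has sum
    \<open>\<sigma>\<close>.\<close>
  have 1: "sum_list (half_sum u v) = \<sigma>"
    "sum_list (half_diff ?z b @ half_diff u v) = - sum_list b / 2"
    using uv(1,4,5) by (simp_all add: sum_list_half sum_list_replicate)
  have "J ?u y = J as y" for y
    unfolding as(1) by (rule J_append_cong) (simp add: uv)
  moreover have "J ?v y = J as y" for y
    unfolding as(1) using J_append_cong[of v cs b y] uv(3) by simp
  moreover have "alternating (Suc n) \<sigma> (half_sum ?u ?v)"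
    unfolding hs using 1(1) uv(6) by (auto simp del: append_assoc)
  moreover have "alternating (Suc n) \<sigma> (half_diff ?u ?v)" if "sum_list as = - \<sigma>"
  proof -
    have "sum_list (half_diff ?z b @ half_diff u v) = \<sigma>" using 1(2) that as by simp
    moreover have "alternating n (- \<sigma>) (half_diff ?z b @ half_diff u v)"
      using uv(7) by (rule alternating_append)
    ultimately show ?thesis unfolding hd alternating.simps by blast
  qed
  moreover have "alternating (Suc n - 1) (- \<sigma>) (half_diff ?u ?v)"
    unfolding hd using uv(7) by (simp add: alternating_append)
  moreover have "length ?u = length ?v" "sum_list ?u = sum_list as" "sum_list ?v = sum_list as"
    using uv as by (auto simp: sum_list_replicate)
  ultimately show ?case by (intro exI[of _ ?u] exI[of _ ?v] conjI allI impI)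
qed

text \<open>The points with \<open>norm (y + s *\<^sub>R x) \<le> t\<close> form a closed convex set
  that \<open>U\<close> does not contain. Separation yields a convex set in \<open>U\<close>
  avoiding it, so the lower bound \<open>t\<close> holds also for averages of points of that
  set.\<close>

lemma J_separate:
  assumes "t < J [s] y"
  obtains C where "convex C" "eventually (\<lambda>x. x \<in> C) U" "\<And>x. x \<in> C \<Longrightarrow> t < norm (y + s *\<^sub>R x)"
proof -
  let ?D = "(\<lambda>x. y + s *\<^sub>R x) -` cball 0 t"
  have lim: "((\<lambda>x. norm (y + s *\<^sub>R x)) \<longlongrightarrow> J [s] y) U" using J_tendsto[of "[]" y s] by simp
  have "closed ?D" by (intro closed_vimage continuous_intros) auto
  moreover have "convex ?D"
  proof (rule convexI)
    fix u v and a b :: real assume *: "u \<in> ?D" "v \<in> ?D" "0 \<le> a" "0 \<le> b" "a + b = 1"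
    have "y = (a + b) *\<^sub>R y" using *(5) by simp
    then have "y + s *\<^sub>R (a *\<^sub>R u + b *\<^sub>R v) = a *\<^sub>R (y + s *\<^sub>R u) + b *\<^sub>R (y + s *\<^sub>R v)"
      by (simp add: algebra_simps)
    moreover have "\<dots> \<in> cball 0 t"
      using convexD[OF convex_cball[of 0 t], of "y + s *\<^sub>R u" "y + s *\<^sub>R v" a b] * by simp
    ultimately show "a *\<^sub>R u + b *\<^sub>R v \<in> ?D" by simp
  qed
  moreover have "\<not> eventually (\<lambda>x. x \<in> ?D) U"
  proof
    assume "eventually (\<lambda>x. x \<in> ?D) U"
    then have "eventually (\<lambda>x. norm (y + s *\<^sub>R x) \<le> t) U" by simp
    then have "J [s] y \<le> t" by (rule tendsto_upperbound[OF lim _ nontriv])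
    then show False using assms by simp
  qed
  ultimately obtain C where "convex C" "C \<inter> ?D = {}" "eventually (\<lambda>x. x \<in> C) U"
    using separate by metis
  then show thesis using that[of C] by (force simp: disjoint_iff)
qed

text \<open>For \<open>a\<close> and \<open>s\<close> of opposite signs convexity cannot be used directly. Instead, average
  \<open>y + a x\<^sub>i + s x\<^sub>i\<^sub>+\<^sub>1\<close> along a chain, which telescopes up to an error of order \<open>1/n\<close>.\<close>

lemma J_merge: "J [a + s] y \<le> J [a, s] y"
proof (rule ccontr)
  assume "\<not> ?thesis"
  then obtain t t' where t: "J [a, s] y < t" "t < t'" "t' < J [a + s] y"
    by (meson dense not_le)
  obtain C where C: "convex C" "eventually (\<lambda>x. x \<in> C) U"
    "\<And>x. x \<in> C \<Longrightarrow> t' < norm (y + (a + s) *\<^sub>R x)"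
    using J_separate[OF t(3)] by metis
  define P where "P x \<longleftrightarrow> x \<in> C \<and> norm x \<le> M \<and> J [s] (y + a *\<^sub>R x) < t" for x
  have "eventually (\<lambda>x. J [s] (y + a *\<^sub>R x) < t) U"
    using order_tendstoD(2)[OF J_tendsto t(1)] .
  then have P: "eventually P U"
    using C(2) bounded unfolding P_def by eventually_elim auto
  \<comment> \<open>\<open>P x\<close> says that almost all successors \<open>w\<close> of
    \<open>x\<close> are good, and almost all \<open>w\<close> satisfy \<open>P\<close> again, so
    the chain never stops.\<close>
  have step: "\<exists>w. P w \<and> norm (y + a *\<^sub>R x + s *\<^sub>R w) < t" if "P x" for x
  proof -
    have "((\<lambda>w. norm ((y + a *\<^sub>R x) + s *\<^sub>R w)) \<longlongrightarrow> J [s] (y + a *\<^sub>R x)) U"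
      using J_tendsto[of "[]" "y + a *\<^sub>R x" s] by simp
    then have "eventually (\<lambda>w. norm ((y + a *\<^sub>R x) + s *\<^sub>R w) < t) U"
      using that order_tendstoD(2) unfolding P_def by metis
    then have "eventually (\<lambda>w. P w \<and> norm ((y + a *\<^sub>R x) + s *\<^sub>R w) < t) U"
      using P by eventually_elim auto
    then show ?thesis by (rule eventually_happens'[OF nontriv])
  qed
  obtain x where x: "\<And>n. P (x n)" "\<And>n. norm (y + a *\<^sub>R x n + s *\<^sub>R x (Suc n)) < t"
  proof -
    have "\<exists>x. P x" using eventually_happens'[OF nontriv P] .
    then have "\<exists>f. \<forall>n. P (f n) \<and> norm (y + a *\<^sub>R f n + s *\<^sub>R f (Suc n)) < t"
      by (rule dependent_nat_choice) (rule step)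
    then obtain f where f: "\<forall>n. P (f n) \<and> norm (y + a *\<^sub>R f n + s *\<^sub>R f (Suc n)) < t" ..
    show thesis by (rule that[of f]) (use f in simp_all)
  qed
  \<comment> \<open>The two ends of the chain leave an error of at most
    \<open>2 * \<bar>s\<bar> * M\<close> in the sum of \<open>n\<close> terms; the average must
    bring it below the gap \<open>t' - t\<close>.\<close>
  obtain n :: nat where n: "2 * \<bar>s\<bar> * M / (t' - t) < real n" "0 < n"
  proof -
    obtain n where "2 * \<bar>s\<bar> * M / (t' - t) < real n" using reals_Archimedean2 by blast
    then show thesis by (intro that[of "Suc n"]) auto
  qed
  define z where "z = (\<Sum>i<n. (1 / real n) *\<^sub>R x i)"
  have "z \<in> C"
    unfolding z_def by (rule convex_sum) (use C(1) n(2) x(1) in \<open>auto simp: P_def\<close>)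
  then have big: "t' < norm (y + (a + s) *\<^sub>R z)" by (rule C(3))
  have z: "real n *\<^sub>R z = (\<Sum>i<n. x i)" using n(2) by (simp add: z_def scaleR_sum_right)
  have "(\<Sum>i<n. y + a *\<^sub>R x i + s *\<^sub>R x (Suc i))
    = real n *\<^sub>R y + (a + s) *\<^sub>R (\<Sum>i<n. x i) + s *\<^sub>R (x n - x 0)"
    by (induction n) (simp_all add: algebra_simps)
  moreover have "real n *\<^sub>R (y + (a + s) *\<^sub>R z) = real n *\<^sub>R y + (a + s) *\<^sub>R (\<Sum>i<n. x i)"
    unfolding z[symmetric] by (simp add: scaleR_add_right mult.commute)
  ultimately have "real n *\<^sub>R (y + (a + s) *\<^sub>R z)
    = (\<Sum>i<n. y + a *\<^sub>R x i + s *\<^sub>R x (Suc i)) - s *\<^sub>R (x n - x 0)"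
    by (simp only: add_diff_cancel_right')
  then have "norm (real n *\<^sub>R (y + (a + s) *\<^sub>R z))
    \<le> norm (\<Sum>i<n. y + a *\<^sub>R x i + s *\<^sub>R x (Suc i)) + norm (s *\<^sub>R (x n - x 0))"
    by (simp only: norm_triangle_ineq4)
  then have "real n * norm (y + (a + s) *\<^sub>R z)
    \<le> norm (\<Sum>i<n. y + a *\<^sub>R x i + s *\<^sub>R x (Suc i)) + norm (s *\<^sub>R (x n - x 0))"
    by (simp only: norm_scaleR abs_of_nat)
  also have "norm (\<Sum>i<n. y + a *\<^sub>R x i + s *\<^sub>R x (Suc i)) \<le> real n * t"
    using sum_norm_bound[of "{..<n}" "\<lambda>i. y + a *\<^sub>R x i + s *\<^sub>R x (Suc i)" t] x(2)
      by (simp add: less_imp_le)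
  also have "norm (s *\<^sub>R (x n - x 0)) \<le> \<bar>s\<bar> * (2 * M)"
  proof -
    have "norm (x n - x 0) \<le> 2 * M"
      using norm_triangle_ineq4[of "x n" "x 0"] x(1)[of n] x(1)[of 0] by (simp add: P_def)
    then show ?thesis by (simp add: mult_left_mono)
  qed
  also have "\<bar>s\<bar> * (2 * M) < real n * (t' - t)"
    using n(1) t(2) by (simp add: field_simps)
  finally have "real n * norm (y + (a + s) *\<^sub>R z) < real n * t'" by (simp add: algebra_simps)
  then show False using big n(2) by simp
qed

text \<open>Copies are merged from the innermost limit outwards, one application of
  \<open>J_merge\<close> per coefficient.\<close>

lemma J_merge_all: "J [sum_list as] y \<le> J as y"
proof (induction as arbitrary: y)
  case (Cons a as)
  have "J [a, sum_list as] y \<le> J (a # as) y"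
    by (rule tendsto_le[OF nontriv J_tendsto J_tendsto]) (simp add: Cons)
  then show ?case using J_merge[of a "sum_list as" y] by simp
qed simp

text \<open>Merging leaves a single coefficient, the sum of the list. Dividing by it turns the norm
  into a distance of \<open>x\<close> from a point of the space, to which \<open>far\<close>
  applies.\<close>

lemma J_far: "\<rho> * \<bar>sum_list as\<bar> \<le> J as y"
proof -
  let ?s = "sum_list as"
  have "\<rho> * \<bar>?s\<bar> \<le> J [?s] y"
  proof (cases "?s = 0")
    case True
    then show ?thesis by simp
  next
    case False
    have lim: "((\<lambda>x. norm (y + ?s *\<^sub>R x)) \<longlongrightarrow> J [?s] y) U" using J_tendsto[of "[]" y ?s] by simp
    show ?thesis
    proof (rule tendsto_lowerbound[OF lim _ nontriv])
      show "\<forall>\<^sub>F x in U. \<rho> * \<bar>?s\<bar> \<le> norm (y + ?s *\<^sub>R x)"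
        using far(2)[of "- (1 / ?s) *\<^sub>R y"]
      proof eventually_elim
        case (elim x)
        have "y + ?s *\<^sub>R x = ?s *\<^sub>R (x - (- (1 / ?s) *\<^sub>R y))"
          using False by (simp add: scaleR_add_right)
        then have "norm (y + ?s *\<^sub>R x) = \<bar>?s\<bar> * norm (x - (- (1 / ?s) *\<^sub>R y))"
          by (metis norm_scaleR)
        then show ?case using mult_left_mono[OF elim, of "\<bar>?s\<bar>"] by (simp add: mult.commute)
      qed
    qed
  qed
  then show ?thesis using J_merge_all order_trans by blast
qed

text \<open>By nonsquareness \<open>S\<close> grows geometrically, but \<open>alternating_exists\<close> bounds it linearly.\<close>

definition S :: "nat \<Rightarrow> real" where "S n = Inf {J as 0 | as. alternating n 1 as}"

text \<open>\<open>S\<close> is defined with the starting sign 1 only; multiplying the list by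
  \<open>\<sigma>\<close> covers the sign -1 without changing the norm.\<close>

lemma S_le:
  assumes "alternating n \<sigma> as" "\<bar>\<sigma>\<bar> = 1"
  shows "S n \<le> J as 0"
proof -
  have "bdd_below {J as 0 | as. alternating n 1 as}"
    by (rule bdd_belowI[of _ 0]) (auto simp: J_nonneg)
  moreover have "alternating n 1 (map ((*) \<sigma>) as)"
    using alternating_scale[OF assms(1), of \<sigma>] assms(2)
      by (simp add: abs_mult_self_eq flip: power2_eq_square)
      (auto simp: power2_eq_square abs_if split: if_splits)
  moreover have "J (map ((*) \<sigma>) as) 0 = J as 0" using J_scale[of \<sigma> as 0] assms(2) by simp
  ultimately show ?thesis unfolding S_def by (metis (mono_tags, lifting) cInf_lower mem_Collect_eq)
qed

text \<open>The witness is \<open>2 * \<sigma>\<close>, \<open>- 2 * \<sigma>\<close>,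
  \<open>2 * \<sigma>\<close> and so on, with last entry \<open>\<sigma>\<close> or
  \<open>- \<sigma>\<close>: each leading entry flips the sign of the tail sum.\<close>

lemma alternating_exists:
  "\<exists>as. alternating (Suc n) \<sigma> as \<and> sum_list as = \<sigma> \<and> (\<Sum>a\<leftarrow>as. \<bar>a\<bar>) \<le> 2 * real (Suc n) * \<bar>\<sigma>\<bar>"
proof (induction n arbitrary: \<sigma>)
  case 0
  show ?case by (intro exI[of _ "[\<sigma>]"]) (auto intro: exI[of _ "[]"])
next
  case (Suc n)
  obtain as where as: "alternating (Suc n) (- \<sigma>) as" "sum_list as = - \<sigma>"
    "(\<Sum>a\<leftarrow>as. \<bar>a\<bar>) \<le> 2 * real (Suc n) * \<bar>\<sigma>\<bar>" using Suc[of "- \<sigma>"] by auto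
  have "alternating (Suc (Suc n)) \<sigma> ((2 * \<sigma>) # as)"
    unfolding alternating.simps(2)[of "Suc n"]
    by (rule exI[of _ "[]"], rule exI[of _ "(2 * \<sigma>) # as"])
       (use as alternating_append[OF as(1), of "[2 * \<sigma>]"] in \<open>simp del: alternating.simps\<close>)
  then show ?case using as(2,3)
    by (intro exI[of _ "(2 * \<sigma>) # as"]) (simp del: alternating.simps add: abs_mult algebra_simps)
qed

lemma S_upper: "S (Suc n) \<le> 2 * M * real (Suc n)"
proof -
  obtain as where as: "alternating (Suc n) 1 as" "(\<Sum>a\<leftarrow>as. \<bar>a\<bar>) \<le> 2 * real (Suc n)"
    using alternating_exists[of n 1] by auto
  have "S (Suc n) \<le> J as 0" using S_le[OF as(1)] by simp
  also have "\<dots> \<le> M * (\<Sum>a\<leftarrow>as. \<bar>a\<bar>)" using J_le[of as 0] by simp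
  also have "\<dots> \<le> M * (2 * real (Suc n))" using as(2) M_nonneg by (rule mult_left_mono)
  finally show ?thesis by (simp add: algebra_simps)
qed

lemma alternating_nonempty: "{J as 0 | as. alternating n 1 as} \<noteq> {}"
  using alternating_exists[of n 1] alternating_Suc[of n 1] by blast

lemma S_lower: "\<rho> \<le> S (Suc 0)"
  unfolding S_def
proof (rule cInf_greatest[OF alternating_nonempty])
  fix r assume "r \<in> {J as 0 | as. alternating (Suc 0) 1 as}"
  then obtain bs cs where "r = J (bs @ cs) 0" "sum_list cs = 1" by auto
  then show "\<rho> \<le> r" using J_append_ge[of \<rho> cs bs 0] J_far[of cs] by simp
qed

text \<open>Spreading \<open>as\<close> gives two lists with the same norm as \<open>as\<close>
  whose half sum and half difference both still alternate \<open>n\<close> times. Neither can have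
  norm below \<open>S n\<close>, while nonsquareness makes one of them smaller than
  \<open>as\<close> by the factor \<open>1 - \<kappa> / 2\<close>.\<close>

lemma S_step: "S n \<le> (1 - \<kappa> / 2) * S (Suc n)"
proof -
  have q: "0 < 1 - \<kappa> / 2" using nonsquare(2) by simp
  have "S n / (1 - \<kappa> / 2) \<le> S (Suc n)"
    unfolding S_def[of "Suc n"]
  proof (rule cInf_greatest[OF alternating_nonempty])
    fix r assume "r \<in> {J as 0 | as. alternating (Suc n) 1 as}"
    then obtain as where as: "r = J as 0" "alternating (Suc n) 1 as" by blast
    obtain u v where uv: "length u = length v" "J u 0 = J as 0" "J v 0 = J as 0"
      "alternating (Suc n) 1 (half_sum u v)" "alternating n (- 1) (half_diff u v)"
      using spread_exists[OF as(2)] by auto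
    have "S n \<le> J (half_sum u v) 0" using S_le[OF alternating_Suc[OF uv(4)]] by simp
    moreover have "S n \<le> J (half_diff u v) 0" using S_le[OF uv(5)] by simp
    ultimately have "S n \<le> (1 - \<kappa> / 2) * r"
      using J_half[OF uv(1)] uv(2,3) as(1) by (simp add: algebra_simps)
    then show "S n / (1 - \<kappa> / 2) \<le> r" using q by (simp add: pos_divide_le_eq mult.commute)
  qed
  then show ?thesis using q by (simp add: pos_divide_le_eq mult.commute)
qed

lemma inconsistent: False
proof -
  let ?q = "1 - \<kappa> / 2"
  have q: "0 < ?q" "?q < 1" using nonsquare(1,2) by auto
  have "\<rho> \<le> ?q ^ n * S (Suc n)" for n
  proof (induction n)
    case 0
    then show ?case using S_lower by simp
  next
    case (Suc n)
    have "?q ^ n * S (Suc n) \<le> ?q ^ n * (?q * S (Suc (Suc n)))"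
      using S_step[of "Suc n"] q by (intro mult_left_mono) auto
    then show ?case using Suc by (simp add: mult.assoc mult.left_commute)
  qed
  also have "?q ^ n * S (Suc n) \<le> ?q ^ n * (2 * M * real (Suc n))" for n
    using S_upper q by (intro mult_left_mono) auto
  finally have "\<rho> \<le> 2 * M * (real n * ?q ^ n) + 2 * M * ?q ^ n" for n
    by (simp add: algebra_simps)
  moreover have "(\<lambda>n. 2 * M * (real n * ?q ^ n) + 2 * M * ?q ^ n) \<longlonglongrightarrow> 2 * M * 0 + 2 * M * 0"
    using q by (intro tendsto_intros powser_times_n_limit_0 LIMSEQ_power_zero) auto
  ultimately have "\<rho> \<le> 2 * M * 0 + 2 * M * 0" by (intro LIMSEQ_le_const) auto
  then show False using far(1) by simp
qed

end

text \<open>An empty intersection produces an instance of \<open>james\<close>, with an ultrafilter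
  refining a maximal family of closed convex sets. Completeness is used for
  \<open>far\<close>.\<close>

theorem uniformly_nonsquare_convex_compact:
  assumes "uniformly_nonsquare TYPE('a::banach)"
  shows "convex_compact TYPE('a)"
  unfolding convex_compact_def
proof (intro allI impI)
  fix \<C> :: "'a set set"
  assume fip: "fip \<C>" and cc: "\<forall>C\<in>\<C>. closed C \<and> convex C" and bd: "\<exists>C\<in>\<C>. bounded C"
  show "\<Inter>\<C> \<noteq> {}"
  proof
    assume empty: "\<Inter>\<C> = {}"
    let ?D = "{C :: 'a set. closed C \<and> convex C}"
    obtain \<F> where \<F>: "\<C> \<subseteq> \<F>" "\<F> \<subseteq> ?D" "fip \<F>"
      and max: "\<And>D. D \<in> ?D \<Longrightarrow> D \<notin> \<F> \<Longrightarrow> \<exists>\<G>\<subseteq>\<F>. finite \<G> \<and> D \<inter> \<Inter>\<G> = {}"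
      using fip_extend_maximal[of \<C> ?D] cc fip
        by (metis (mono_tags, lifting) mem_Collect_eq subsetI)
    have meet: "cball x r \<in> \<F>" if "\<And>\<G>. \<G> \<subseteq> \<F> \<Longrightarrow> finite \<G> \<Longrightarrow> cball x r \<inter> \<Inter>\<G> \<noteq> {}" for x r
      using max[of "cball x r"] that by (metis closed_cball convex_cball mem_Collect_eq)
    obtain U where U: "U \<le> fip_filter \<F>" "ultra U"
      using ultra_exists[OF fip_filter_neq_bot[OF \<F>(3)]] by blast
    have UF: "eventually (\<lambda>x. x \<in> C) U" if "C \<in> \<F>" for C
      using eventually_fip_filterI[OF that] U(1) by (simp add: filter_leD)
    have UG: "eventually (\<lambda>x. x \<in> \<Inter>\<G>) U" if "\<G> \<subseteq> \<F>" "finite \<G>" for \<G>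
      using that UF by (simp add: eventually_ball_finite subset_iff)
    \<comment> \<open>If no radius works, maximality puts arbitrarily small balls into
      \<open>\<F>\<close>. Any two of them meet, so their centres form a Cauchy sequence, and its
      limit lies in every member of \<open>\<C>\<close>, which is excluded.\<close>
    have "\<exists>\<rho>>0. \<forall>x. \<exists>\<G>\<subseteq>\<F>. finite \<G> \<and> cball x \<rho> \<inter> \<Inter>\<G> = {}"
    proof (rule ccontr)
      assume "\<not> ?thesis"
      then have "\<forall>\<rho>>0. \<exists>x. \<forall>\<G>\<subseteq>\<F>. finite \<G> \<longrightarrow> cball x \<rho> \<inter> \<Inter>\<G> \<noteq> {}" by meson
      then have "\<forall>n. \<exists>x. cball x (inverse (real (Suc n))) \<in> \<F>"
        using meet by (metis inverse_positive_iff_positive of_nat_0_less_iff zero_less_Suc)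
      then obtain x where x: "\<And>n. cball (x n) (inverse (real (Suc n))) \<in> \<F>" by metis
      have two: "A \<inter> B \<noteq> {}" if "A \<in> \<F>" "B \<in> \<F>" for A B
        using \<F>(3)[unfolded fip_def, rule_format, of "{A, B}"] that by simp
      have d: "dist (x m) (x n) \<le> inverse (real (Suc m)) + inverse (real (Suc n))" for m n
      proof -
        obtain y where "dist (x m) y \<le> inverse (real (Suc m))"
          "dist (x n) y \<le> inverse (real (Suc n))"
          using two[OF x[of m] x[of n]] by auto
        then show ?thesis using dist_triangle2[of "x m" "x n" y] by linarith
      qed
      have "Cauchy x"
      proof (rule metric_CauchyI)
        fix e :: real assume "0 < e"
        then obtain N where N: "inverse (real (Suc N)) < e / 2"
          using reals_Archimedean[of "e/2"] by auto
        have "dist (x m) (x n) < e" if "m \<ge> N" "n \<ge> N" for m n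
        proof -
          have "inverse (real (Suc m)) \<le> inverse (real (Suc N))"
            "inverse (real (Suc n)) \<le> inverse (real (Suc N))"
            using that by (auto intro!: le_imp_inverse_le)
          then show ?thesis using d[of m n] N by linarith
        qed
        then show "\<exists>N. \<forall>m\<ge>N. \<forall>n\<ge>N. dist (x m) (x n) < e" by blast
      qed
      then obtain w where w: "x \<longlonglongrightarrow> w" using Cauchy_convergent convergent_def by blast
      have "w \<in> C" if C: "C \<in> \<C>" for C
      proof -
        have "closed C" "C \<in> \<F>" using cc C \<F>(1) by auto
        have "\<forall>n. \<exists>c\<in>C. dist (x n) c \<le> inverse (real (Suc n))" using two[OF x \<open>C \<in> \<F>\<close>] by fastforce
        then obtain c where c: "\<And>n. c n \<in> C" "\<And>n. dist (x n) (c n) \<le> inverse (real (Suc n))"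
          by metis
        have "(\<lambda>n. dist (x n) (c n)) \<longlonglongrightarrow> 0"
          by (rule tendsto_sandwich[OF _ _ tendsto_const LIMSEQ_inverse_real_of_nat])
            (use c in auto)
        then have "(\<lambda>n. x n - c n) \<longlonglongrightarrow> 0" by (simp add: dist_norm tendsto_norm_zero_iff)
        then have "(\<lambda>n. x n - (x n - c n)) \<longlonglongrightarrow> w - 0" by (intro tendsto_diff w)
        then have "c \<longlonglongrightarrow> w" by simp
        with \<open>closed C\<close> c(1) show ?thesis by (rule closed_sequentially)
      qed
      then show False using empty by blast
    qed
    then obtain \<rho> where \<rho>: "0 < \<rho>" "\<forall>x. \<exists>\<G>\<subseteq>\<F>. finite \<G> \<and> cball x \<rho> \<inter> \<Inter>\<G> = {}"
      by (elim exE conjE)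
    obtain \<kappa> where \<kappa>: "0 < \<kappa>" "\<kappa> \<le> 1"
      "\<And>x y::'a. min (norm (x + y)) (norm (x - y)) \<le> norm x + norm y - \<kappa> * min (norm x) (norm y)"
      using uniformly_nonsquareE[OF assms] by metis
    obtain B M where B: "B \<in> \<C>" "\<And>x. x \<in> B \<Longrightarrow> norm x \<le> M" using bd unfolding bounded_iff by blast
    interpret james U M \<rho> \<kappa>
    proof
      show "\<forall>\<^sub>F x in U. norm x \<le> M"
        by (rule eventually_mono[OF UF[OF subsetD[OF \<F>(1) B(1)]]]) (rule B(2))
      show "\<forall>\<^sub>F x in U. \<rho> \<le> norm (x - w)" for w
      proof -
        from spec[OF \<rho>(2), of w] obtain \<G> where G: "\<G> \<subseteq> \<F>" "finite \<G>" "cball w \<rho> \<inter> \<Inter>\<G> = {}"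
          by (elim exE conjE)
        show ?thesis using UG[OF G(1,2)]
        proof eventually_elim
          case (elim x)
          then have "x \<notin> cball w \<rho>" using G(3) by blast
          then show ?case by (simp add: dist_norm norm_minus_commute)
        qed
      qed
      show "(\<forall>\<^sub>F x in U. x \<in> D) \<or> (\<exists>C. convex C \<and> C \<inter> D = {} \<and> (\<forall>\<^sub>F x in U. x \<in> C))"
        if "closed D" "convex D" for D
      proof (cases "D \<in> \<F>")
        case True
        then show ?thesis using UF by blast
      next
        case False
        have "\<exists>\<G>\<subseteq>\<F>. finite \<G> \<and> D \<inter> \<Inter>\<G> = {}" by (rule max) (use that False in auto)
        then obtain \<G> where G: "\<G> \<subseteq> \<F>" "finite \<G>" "D \<inter> \<Inter>\<G> = {}" by (elim exE conjE)
        have "convex (\<Inter>\<G>)" using G(1) \<F>(2) by (intro convex_Inter) auto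
        then show ?thesis
          using UG[OF G(1,2)] G(3) by (intro disjI2 exI[of _ "\<Inter>\<G>"]) (simp add: inf_commute)
      qed
    qed (use U \<rho> \<kappa> in auto)
    show False by (rule inconsistent)
  qed
qed

lemma convex_compactD:
  fixes B :: "'a::real_normed_vector set"
  assumes "convex_compact TYPE('a)" "fip \<C>" "\<And>C. C \<in> \<C> \<Longrightarrow> closed C" "\<And>C. C \<in> \<C> \<Longrightarrow> convex C"
    and "B \<in> \<C>" "bounded B"
  shows "\<exists>w. \<forall>C\<in>\<C>. w \<in> C"
proof -
  have "\<forall>C\<in>\<C>. closed C \<and> convex C" "\<exists>C\<in>\<C>. bounded C" using assms by auto
  then have "\<Inter>\<C> \<noteq> {}" using assms(1,2) by (simp add: convex_compact_def)
  then show ?thesis by auto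
qed

section \<open>Weak limits\<close>

text \<open>By the separation theorem this is weak convergence if \<open>F\<close> is an ultrafilter.\<close>

definition weak_lim :: "'i filter \<Rightarrow> ('i \<Rightarrow> 'a::real_normed_vector) \<Rightarrow> 'a \<Rightarrow> bool" where
  "weak_lim F x w \<longleftrightarrow> (\<forall>C. closed C \<longrightarrow> convex C \<longrightarrow> eventually (\<lambda>n. x n \<in> C) F \<longrightarrow> w \<in> C)"

lemma weak_limD: "weak_lim F x w \<Longrightarrow> closed C \<Longrightarrow> convex C \<Longrightarrow> eventually (\<lambda>n. x n \<in> C) F \<Longrightarrow> w \<in> C"
  by (simp add: weak_lim_def)

lemma weak_lim_exists:
  fixes x :: "'i \<Rightarrow> 'a::real_normed_vector"
  assumes cc: "convex_compact TYPE('a)" and F: "F \<noteq> bot" and bd: "eventually (\<lambda>n. norm (x n) \<le> M) F"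
  obtains w where "weak_lim F x w"
proof -
  let ?C = "{C. closed C \<and> convex C \<and> eventually (\<lambda>n. x n \<in> C) F}"
  have "fip ?C"
    unfolding fip_def
  proof (intro allI impI)
    fix \<G> assume G: "\<G> \<subseteq> ?C" "finite \<G>"
    have "eventually (\<lambda>n. \<forall>C\<in>\<G>. x n \<in> C) F"
      by (rule eventually_ball_finite) (use G in auto)
    then have "\<exists>n. \<forall>C\<in>\<G>. x n \<in> C" by (rule eventually_happens'[OF F])
    then show "\<Inter>\<G> \<noteq> {}" by auto
  qed
  then have "\<exists>w. \<forall>C\<in>?C. w \<in> C"
    by (rule convex_compactD[OF cc, where B = "cball 0 M"]) (use bd in auto)
  then obtain w where w: "\<forall>C\<in>?C. w \<in> C" ..
  show thesis by (rule that[of w]) (use w in \<open>simp add: weak_lim_def\<close>)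
qed

text \<open>The first limit is prescribed because later \<open>z\<close> is constructed from
  \<open>w\<close>. A closed convex set in the product may couple the coordinates and its slice over
  \<open>w\<close> may be hard to reach, so the slice is thickened: \<open>D C e\<close> collects
  the second coordinates of points of \<open>C\<close> whose first coordinate is within
  \<open>e\<close> of \<open>w\<close>. These sets are nonempty since \<open>w\<close> lies in the
  closure of the projection of \<open>C\<close>.\<close>

lemma weak_lim_Pair:
  fixes z :: "'i \<Rightarrow> 'b::real_normed_vector" and x :: "'i \<Rightarrow> 'a::real_normed_vector"
  assumes cc: "convex_compact TYPE('b)" and F: "F \<noteq> bot" and w: "weak_lim F x w"
    and bd: "eventually (\<lambda>n. norm (z n) \<le> M) F"
  obtains v where "weak_lim F (\<lambda>n. (x n, z n)) (w, v)"
proof -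
  define D where "D C e = closure (snd ` (C \<inter> cball w e \<times> UNIV))" for C :: "('a \<times> 'b) set" and e
  define good where "good C \<longleftrightarrow> closed C \<and> convex C \<and> eventually (\<lambda>n. (x n, z n) \<in> C) F" for C
  have ne: "D C e \<noteq> {}" if ge: "good C" "0 < e" for C e
  proof -
    have "w \<in> closure (fst ` C)"
    proof (rule weak_limD[OF w])
      show "convex (closure (fst ` C))"
        using ge by (intro convex_closure convex_linear_image) (auto simp: good_def linear_fst)
      show "eventually (\<lambda>n. x n \<in> closure (fst ` C)) F"
        using ge(1) unfolding good_def
        by (elim conjE eventually_mono) (metis closure_subset fst_conv image_eqI subsetD)
    qed simp
    then obtain p where "p \<in> C" "dist (fst p) w < e"
      using ge(2) by (auto simp: closure_approachable)
    then have "snd p \<in> snd ` (C \<inter> cball w e \<times> UNIV)"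
      by (intro imageI) (auto simp: mem_Times_iff dist_commute)
    then show ?thesis unfolding D_def using closure_subset by blast
  qed
  let ?D = "{D C e | C e. good C \<and> 0 < e}"
  \<comment> \<open>Intersecting the sets \<open>C\<close> and shrinking \<open>e\<close> stays
    inside each given \<open>D C e\<close>, so nonemptiness of single sets already gives the finite
    intersection property.\<close>
  have directed: "\<exists>C e. good C \<and> 0 < e \<and> D C e \<subseteq> \<Inter>\<G>" if "finite \<G>" "\<G> \<subseteq> ?D" for \<G>
    using that
  proof (induction \<G>)
    case empty
    have "good UNIV" by (simp add: good_def)
    then show ?case by (intro exI[of _ UNIV] exI[of _ 1]) auto
  next
    case (insert A \<G>)
    then obtain C e where 1: "good C" "0 < e" "D C e \<subseteq> \<Inter>\<G>" by auto
    obtain C' e' where 2: "good C'" "0 < e'" "A = D C' e'" using insert by auto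
    have "good (C \<inter> C')"
      using 1(1) 2(1) by (auto simp: good_def intro: convex_Int eventually_conj)
    moreover have "D (C \<inter> C') (min e e') \<subseteq> D C e" "D (C \<inter> C') (min e e') \<subseteq> D C' e'"
      unfolding D_def by (intro closure_mono image_mono; auto)+
    ultimately show ?case using 1 2 by (intro exI[of _ "C \<inter> C'"] exI[of _ "min e e'"]) auto
  qed
  have "fip ?D"
    unfolding fip_def
  proof (intro allI impI)
    fix \<G> assume "\<G> \<subseteq> ?D" "finite \<G>"
    then obtain C e where "good C" "0 < e" "D C e \<subseteq> \<Inter>\<G>" using directed[of \<G>] by auto
    then show "\<Inter>\<G> \<noteq> {}" using ne[of C e] by auto
  qed
  then have "\<exists>v. \<forall>A\<in>?D. v \<in> A"
  proof (rule convex_compactD[OF cc])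
    show "closed A" "convex A" if "A \<in> ?D" for A
      using that by
        (auto simp: D_def good_def intro!: convex_closure convex_linear_image convex_Int
        convex_Times linear_snd)
    show "D (UNIV \<times> cball 0 M) 1 \<in> ?D"
      using bd by (auto simp: good_def intro!: exI[of _ "UNIV \<times> cball 0 M"] exI[of _ 1] closed_Times
        convex_Times)
    show "bounded (D (UNIV \<times> cball 0 M) 1)"
      unfolding D_def by (rule bounded_closure, rule bounded_subset[OF bounded_cball[of 0 M]]) auto
  qed
  then obtain v where "\<forall>A\<in>?D. v \<in> A" ..
  then have v: "v \<in> D C e" if "good C" "0 < e" for C e using that by auto
  have "weak_lim F (\<lambda>n. (x n, z n)) (w, v)"
    unfolding weak_lim_def
  proof (intro allI impI)
    fix C assume C: "closed C" "convex C" "\<forall>\<^sub>F n in F. (x n, z n) \<in> C"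
    have "(w, v) \<in> closure C"
      unfolding closure_approachable
    proof (intro allI impI)
      fix e :: real assume e: "0 < e"
      have "v \<in> D C (e / 2)" using C e by (intro v) (auto simp: good_def)
      then obtain p where p: "p \<in> C" "dist w (fst p) \<le> e / 2" "dist (snd p) v < e / 2"
      proof -
        assume v: "v \<in> D C (e / 2)"
        obtain q where "q \<in> C \<inter> cball w (e / 2) \<times> UNIV" "dist (snd q) v < e / 2"
          using v[unfolded D_def closure_approachable, rule_format, of "e / 2"] e by auto
        then show thesis by (intro that[of q]) (auto simp: mem_Times_iff)
      qed
      have "dist p (w, v) \<le> dist (fst p) w + dist (snd p) v"
        unfolding dist_prod_def by (simp add: sqrt_sum_squares_le_sum)
      then show "\<exists>p\<in>C. dist p (w, v) < e" using p by (intro bexI[of _ p]) (auto simp: dist_commute)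
    qed
    then show "(w, v) \<in> C" using C(1) by simp
  qed
  then show thesis by (rule that)
qed

text \<open>Along the filter generated by the family, the two coordinate projections have a joint
  weak limit, and that point lies in every member.\<close>

lemma convex_compact_prod:
  assumes "convex_compact TYPE('a::real_normed_vector)"
    "convex_compact TYPE('b::real_normed_vector)"
  shows "convex_compact TYPE('a \<times> 'b)"
  unfolding convex_compact_def
proof (intro allI impI)
  fix \<C> :: "('a \<times> 'b) set set"
  assume fip: "fip \<C>" and cc: "\<forall>C\<in>\<C>. closed C \<and> convex C" and bd: "\<exists>C\<in>\<C>. bounded C"
  let ?F = "fip_filter \<C>"
  have F: "?F \<noteq> bot" by (rule fip_filter_neq_bot[OF fip])
  obtain B M where B: "B \<in> \<C>" "\<forall>p\<in>B. norm p \<le> M" using bd unfolding bounded_iff by auto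
  have ev: "eventually (\<lambda>p. p \<in> C) ?F" if "C \<in> \<C>" for C
    using that by (rule eventually_fip_filterI)
  have le: "norm (fst p) \<le> M" "norm (snd p) \<le> M" if "p \<in> B" for p
    using bspec[OF B(2) that] norm_fst_le[of "fst p" "snd p"] norm_snd_le[of "snd p" "fst p"]
      by auto
  have 1: "eventually (\<lambda>p. norm (fst p) \<le> M) ?F"
    by (rule eventually_mono[OF ev[OF B(1)] le(1)])
  have 2: "eventually (\<lambda>p. norm (snd p) \<le> M) ?F"
    by (rule eventually_mono[OF ev[OF B(1)] le(2)])
  obtain w where w: "weak_lim ?F fst w" by (rule weak_lim_exists[OF assms(1) F 1])
  obtain v where "weak_lim ?F (\<lambda>p. (fst p, snd p)) (w, v)"
    by (rule weak_lim_Pair[OF assms(2) F w 2])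
  then have "(w, v) \<in> C" if "C \<in> \<C>" for C
    using that cc ev[OF that] by (auto simp: weak_lim_def)
  then show "\<Inter>\<C> \<noteq> {}" by auto
qed

lemma weak_lim_linear:
  assumes "weak_lim F x w" "bounded_linear f"
  shows "weak_lim F (\<lambda>n. f (x n)) (f w)"
  unfolding weak_lim_def
proof (intro allI impI)
  fix C assume C: "closed C" "convex C" "\<forall>\<^sub>F n in F. f (x n) \<in> C"
  have "w \<in> f -` C"
    by (rule weak_limD[OF assms(1)])
      (use C assms(2) in \<open>auto intro!: closed_vimage convex_linear_vimage bounded_linear.linear
        simp: linear_continuous_on linear_continuous_at\<close>)
  then show "f w \<in> C" by simp
qed

text \<open>Weak lower semicontinuity: the sublevel sets of \<open>q\<close> at heights
  \<open>l + e\<close> are closed and convex and eventually contain \<open>x n\<close>.\<close>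

lemma weak_lim_convex_le:
  assumes w: "weak_lim F x w" and F: "F \<noteq> bot" and q: "convex_on UNIV q" "continuous_on UNIV q"
    and lim: "((\<lambda>n. q (x n)) \<longlongrightarrow> l) F"
  shows "q w \<le> (l::real)"
proof (rule field_le_epsilon)
  fix e :: real assume "0 < e"
  have "w \<in> {y \<in> UNIV. q y \<le> l + e}"
  proof (rule weak_limD[OF w])
    show "convex {y \<in> UNIV. q y \<le> l + e}" 
    proof (rule convexI)
      fix u v and a b :: real
      assume uv: "u \<in> {y \<in> UNIV. q y \<le> l + e}" "v \<in> {y \<in> UNIV. q y \<le> l + e}" "0 \<le> a" "0 \<le> b"
        "a + b = 1"
      have "q (a *\<^sub>R u + b *\<^sub>R v) \<le> a * q u + b * q v" using q(1) uv unfolding convex_on_def by simp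
      also have "\<dots> \<le> l + e" using uv by (intro convex_bound_le) auto
      finally show "a *\<^sub>R u + b *\<^sub>R v \<in> {y \<in> UNIV. q y \<le> l + e}" by simp
    qed
    show "closed {y \<in> UNIV. q y \<le> l + e}"
      using closed_Collect_le[OF q(2) continuous_on_const] by simp
    have "eventually (\<lambda>n. q (x n) < l + e) F" using order_tendstoD(2)[OF lim] \<open>0 < e\<close> by simp
    then show "eventually (\<lambda>n. x n \<in> {y \<in> UNIV. q y \<le> l + e}) F" by eventually_elim simp
  qed
  then show "q w \<le> l + e" by simp
qed

lemma ultra_tendsto_norm:
  assumes "ultra U" "\<And>n. norm (x n) \<le> M"
  shows "((\<lambda>n. norm (x n)) \<longlongrightarrow> Lim U (\<lambda>n. norm (x n))) U"
  by (rule ultra_tendsto_Lim[OF assms(1), of _ M]) (simp add: assms(2))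

text \<open>Nonsquareness is applied to \<open>w - p\<close> and \<open>z\<^sub>n - z\<^sub>m\<close>: by weak lower semicontinuity their sum
  (let \<open>m\<close> tend to infinity) and their difference (let \<open>n\<close> tend to infinity) have iterated limits at
  least \<open>lim \<parallel>z\<^sub>n - p\<parallel>\<close>.\<close>

lemma nonsquare_weak_lim:
  fixes z :: "nat \<Rightarrow> 'a::real_normed_vector"
  assumes U: "ultra U" and w: "weak_lim U z w" and bd: "\<And>n. norm (z n) \<le> M"
    and \<kappa>: "0 < \<kappa>"
      "\<And>x y::'a. min (norm (x + y)) (norm (x - y)) \<le> norm x + norm y - \<kappa> * min (norm x) (norm y)"
  defines "\<gamma> \<equiv> Lim U (\<lambda>n. Lim U (\<lambda>m. norm (z n - z m)))"
  shows "Lim U (\<lambda>n. norm (z n - p)) \<le> norm (w - p) + \<gamma> - \<kappa> * min (norm (w - p)) \<gamma>"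
proof -
  have nb: "U \<noteq> bot" using U by (simp add: ultra_def)
  have lim: "((\<lambda>m. norm (z m - v)) \<longlongrightarrow> Lim U (\<lambda>m. norm (z m - v))) U" for v
    by (rule ultra_tendsto_norm[OF U, of _ "M + norm v"])
      (use bd norm_triangle_ineq4 in \<open>meson add_right_mono order_trans\<close>)
  \<comment> \<open>The asymptotic distance of \<open>z\<close> from a point. It inherits convexity
    and the Lipschitz bound from the norm, so lower semicontinuity applies to \<open>h\<close>
    itself in the second of the two limits.\<close>
  define h where "h v = Lim U (\<lambda>m. norm (z m - v))" for v
  have h: "((\<lambda>m. norm (z m - v)) \<longlongrightarrow> h v) U" "((\<lambda>m. norm (v - z m)) \<longlongrightarrow> h v) U" for v
    using lim[of v] by (simp_all add: h_def norm_minus_commute)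
  have h_eq: "h v = Lim U (\<lambda>m. norm (v - z m))" for v by (simp add: h_def norm_minus_commute)
  have h_nonneg: "0 \<le> h v" for v
    by (rule tendsto_lowerbound[OF h(1) _ nb]) simp
  have h_lip: "h u \<le> h v + norm (u - v)" for u v
  proof (rule tendsto_le[OF nb _ h(1)])
    show "((\<lambda>m. norm (z m - v) + norm (u - v)) \<longlongrightarrow> h v + norm (u - v)) U"
      by (intro tendsto_intros h)
    have "norm (z m - u) \<le> norm (z m - v) + norm (u - v)" for m
      using norm_triangle_ineq4[of "z m - v" "u - v"] by simp
    then show "\<forall>\<^sub>F m in U. norm (z m - u) \<le> norm (z m - v) + norm (u - v)" by simp
  qed
  have h_le: "h v \<le> M + norm v" for v
  proof (rule tendsto_upperbound[OF h(1) _ nb])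
    have "norm (z m - v) \<le> M + norm v"
      for m using norm_triangle_ineq4[of "z m" v] bd[of m] by linarith
    then show "\<forall>\<^sub>F m in U. norm (z m - v) \<le> M + norm v" by simp
  qed
  have h_cont: "continuous_on UNIV h"
    unfolding continuous_on_iff
  proof (intro ballI allI impI)
    fix v and e :: real assume e: "0 < e"
    have "dist (h u) (h v) < e" if "dist u v < e" for u
      using that h_lip[of u v] h_lip[of v u]
        by (simp add: dist_norm abs_le_iff norm_minus_commute abs_less_iff)
    then show "\<exists>d>0. \<forall>u\<in>UNIV. dist u v < d \<longrightarrow> dist (h u) (h v) < e" using e by auto
  qed
  have h_convex: "convex_on UNIV h"
    unfolding convex_on_def
  proof (intro conjI ballI allI impI)
    fix u v and a b :: real assume ab: "0 \<le> a" "0 \<le> b" "a + b = 1"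
    have "norm (z m - (a *\<^sub>R u + b *\<^sub>R v)) \<le> a * norm (z m - u) + b * norm (z m - v)" for m
    proof -
      have "z m = (a + b) *\<^sub>R z m" using ab by simp
      then have "z m - (a *\<^sub>R u + b *\<^sub>R v) = a *\<^sub>R (z m - u) + b *\<^sub>R (z m - v)"
        by (simp add: algebra_simps)
      then show ?thesis using norm_triangle_ineq[of "a *\<^sub>R (z m - u)" "b *\<^sub>R (z m - v)"] ab by simp
    qed
    then have "\<forall>\<^sub>F m in U. norm (z m - (a *\<^sub>R u + b *\<^sub>R v))
      \<le> a * norm (z m - u) + b * norm (z m - v)" by simp
    then show "h (a *\<^sub>R u + b *\<^sub>R v) \<le> a * h u + b * h v"
      by (rule tendsto_le[OF nb _ h(1), rotated]) (intro tendsto_intros h)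
  qed simp
  define P where "P n = Lim U (\<lambda>m. norm ((w - p + z n) - z m))" for n
  have P_h: "P n = h (w - p + z n)" for n by (simp add: P_def h_eq)
  have hz: "((\<lambda>n. h (z n)) \<longlongrightarrow> \<gamma>) U"
  proof -
    have "\<gamma> = Lim U (\<lambda>n. h (z n))" by (simp add: \<gamma>_def h_eq)
    moreover have "\<bar>h (z n)\<bar> \<le> M + M"
      for n using h_nonneg[of "z n"] h_le[of "z n"] bd[of n] by linarith
    ultimately show ?thesis using ultra_tendsto_Lim[OF U, of "\<lambda>n. h (z n)" "M + M"] by simp
  qed
  have bounded_h: "\<bar>h (z n + v)\<bar> \<le> 2 * M + norm v" for n v
    using h_nonneg[of "z n + v"] h_le[of "z n + v"] bd[of n] norm_triangle_ineq[of "z n" v]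
      by linarith
  have lim_h: "((\<lambda>n. h (z n + v)) \<longlongrightarrow> Lim U (\<lambda>n. h (z n + v))) U" for v
    by (rule ultra_tendsto_Lim[OF U, of _ "2 * M + norm v"]) (simp add: bounded_h)
  let ?d = "h p"
  \<comment> \<open>For fixed \<open>n\<close> the limit is taken in \<open>m\<close>: replacing
    \<open>z m\<close> by its weak limit \<open>w\<close> cancels the shift
    \<open>w - p\<close>.\<close>
  have A: "?d \<le> Lim U (\<lambda>n. h (z n + (w - p)))"
  proof (rule tendsto_le[OF nb lim_h h(1)])
    have "norm (z n - p) \<le> h (z n + (w - p))" for n
    proof -
      let ?q = "\<lambda>v. norm ((z n + (w - p)) - v)"
      have "?q w \<le> h (z n + (w - p))"
      proof (rule weak_lim_convex_le[OF w nb _ _ h(2)])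
        show "convex_on UNIV ?q"
          using convex_on_dist[of UNIV "z n + (w - p)"] by (simp add: dist_norm)
      qed (intro continuous_intros)
      then show ?thesis by (simp add: algebra_simps)
    qed
    then show "\<forall>\<^sub>F n in U. norm (z n - p) \<le> h (z n + (w - p))" by simp
  qed
  \<comment> \<open>Here the limit is taken in \<open>n\<close>: the convex function
    \<open>h (v + (p - w))\<close> at the weak limit \<open>v = w\<close> is
    \<open>h p\<close>.\<close>
  have B: "?d \<le> Lim U (\<lambda>n. h (z n + (p - w)))"
  proof -
    have 1: "convex_on UNIV (\<lambda>v. h (v + (p - w)))"
      unfolding convex_on_def
    proof (intro conjI ballI allI impI)
      fix u v and a b :: real assume ab: "0 \<le> a" "0 \<le> b" "a + b = 1"
      have "a *\<^sub>R (u + (p - w)) + b *\<^sub>R (v + (p - w)) = a *\<^sub>R u + b *\<^sub>R v + (a + b) *\<^sub>R (p - w)"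
        unfolding scaleR_add_right scaleR_add_left by (simp only: add_ac)
      then have "a *\<^sub>R u + b *\<^sub>R v + (p - w) = a *\<^sub>R (u + (p - w)) + b *\<^sub>R (v + (p - w))"
        by (simp only: ab(3) scaleR_one)
      then show "h (a *\<^sub>R u + b *\<^sub>R v + (p - w)) \<le> a * h (u + (p - w)) + b * h (v + (p - w))"
        using h_convex ab unfolding convex_on_def by simp
    qed simp
    have 2: "continuous_on UNIV (\<lambda>v. h (v + (p - w)))"
      by (intro continuous_on_compose2[OF h_cont] continuous_intros) auto
    show ?thesis using weak_lim_convex_le[OF w nb 1 2 lim_h] by simp
  qed
  let ?a = "norm (w - p)"
  have pw: "min (h (z n + (w - p))) (h (z n + (p - w))) \<le> ?a + h (z n) - \<kappa> * min ?a (h (z n))" for n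
  proof (rule tendsto_le[OF nb])
    show "((\<lambda>m. min (norm ((z n + (w - p)) - z m)) (norm ((z n + (p - w)) - z m))) \<longlongrightarrow>
        min (h (z n + (w - p))) (h (z n + (p - w)))) U"
      by (intro tendsto_min h)
    show "((\<lambda>m. ?a + norm (z n - z m) - \<kappa> * min ?a (norm (z n - z m))) \<longlongrightarrow> ?a + h (z n) - \<kappa> * min ?a (h (z n))) U"
      by (intro tendsto_intros tendsto_min h)
    have "min (norm ((z n + (w - p)) - z m)) (norm ((z n + (p - w)) - z m))
        \<le> ?a + norm (z n - z m) - \<kappa> * min ?a (norm (z n - z m))" for m
    proof -
      have "(z n + (w - p)) - z m = (w - p) + (z n - z m)"
        "(z n + (p - w)) - z m = - ((w - p) - (z n - z m))"
        by (simp_all add: algebra_simps)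
      then show ?thesis using \<kappa>(2)[of "w - p" "z n - z m"] by (simp only: norm_minus_cancel)
    qed
    then show "\<forall>\<^sub>F m in U. min (norm ((z n + (w - p)) - z m)) (norm ((z n + (p - w)) - z m))
        \<le> ?a + norm (z n - z m) - \<kappa> * min ?a (norm (z n - z m))" by simp
  qed
  have "min (Lim U (\<lambda>n. h (z n + (w - p)))) (Lim U (\<lambda>n. h (z n + (p - w)))) \<le> ?a + \<gamma> - \<kappa> * min ?a \<gamma>"
  proof (rule tendsto_le[OF nb])
    show "((\<lambda>n. min (h (z n + (w - p))) (h (z n + (p - w)))) \<longlongrightarrow>
      min (Lim U (\<lambda>n. h (z n + (w - p)))) (Lim U (\<lambda>n. h (z n + (p - w))))) U"
      by (intro tendsto_min lim_h)
    show "((\<lambda>n. ?a + h (z n) - \<kappa> * min ?a (h (z n))) \<longlongrightarrow> ?a + \<gamma> - \<kappa> * min ?a \<gamma>) U"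
      by (intro tendsto_intros tendsto_min hz)
  qed (simp add: pw)
  then show ?thesis using A B unfolding h_def[of p] by linarith
qed

section \<open>Minimal invariant sets\<close>

definition invariant_set :: "('v::real_normed_vector \<Rightarrow> 'v) \<Rightarrow> 'v set \<Rightarrow> bool" where
  "invariant_set T K \<longleftrightarrow> K \<noteq> {} \<and> closed K \<and> convex K \<and> T ` K \<subseteq> K"

definition minimal_invariant :: "('v::real_normed_vector \<Rightarrow> 'v) \<Rightarrow> 'v set \<Rightarrow> bool" where
  "minimal_invariant T K \<longleftrightarrow> invariant_set T K \<and> (\<forall>L. L \<subseteq> K \<longrightarrow> invariant_set T L \<longrightarrow> L = K)"

text \<open>A chain of invariant sets has the finite intersection property, since finitely many
  members include a smallest one; convex compactness makes its intersection nonempty.\<close>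

lemma minimal_invariant_exists:
  fixes C :: "'v::real_normed_vector set"
  assumes cc: "convex_compact TYPE('v)" and C: "invariant_set T C" "bounded C"
  obtains K where "K \<subseteq> C" "minimal_invariant T K"
proof -
  \<comment> \<open>Complements turn the search for a minimal set into one for a maximal
    element.\<close>
  let ?A = "uminus ` {K. K \<subseteq> C \<and> invariant_set T K}"
  have "\<exists>M\<in>?A. \<forall>X\<in>?A. M \<subseteq> X \<longrightarrow> X = M"
  proof (rule subset_Zorn_nonempty)
    show "?A \<noteq> {}" using C(1) by auto
    fix \<C> assume ne: "\<C> \<noteq> {}" and ch: "subset.chain ?A \<C>"
    let ?B = "uminus ` \<C>"
    have B: "K \<subseteq> C" "invariant_set T K" if "K \<in> ?B" for K
      using that ch by (auto simp: subset.chain_def)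
    have lin: "K \<subseteq> L \<or> L \<subseteq> K" if KL: "K \<in> ?B" "L \<in> ?B" for K L
    proof -
      obtain X Y where XY: "K = - X" "L = - Y" "X \<in> \<C>" "Y \<in> \<C>" using KL by auto
      then have "X \<subseteq> Y \<or> Y \<subseteq> X"
        using bspec[OF bspec[OF conjunct2[OF ch[unfolded subset.chain_def]] XY(3)] XY(4)] by auto
      then show ?thesis using XY by auto
    qed
    have min: "\<exists>K\<in>?B. K \<subseteq> \<Inter>\<G>" if "finite \<G>" "\<G> \<subseteq> ?B" for \<G>
      using that
    proof (induction \<G>)
      case empty
      then show ?case using ne by auto
    next
      case (insert L \<G>)
      then obtain K where K: "K \<in> ?B" "K \<subseteq> \<Inter>\<G>" by auto
      have L: "L \<in> ?B" using insert by auto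
      from lin[OF K(1) L] show ?case
      proof
        assume "K \<subseteq> L"
        then show ?thesis using K by (intro bexI[OF _ K(1)]) auto
      next
        assume "L \<subseteq> K"
        then show ?thesis using K by (intro bexI[OF _ L]) auto
      qed
    qed
    have fip: "fip ?B"
      unfolding fip_def
    proof (intro allI impI)
      fix \<G> assume "\<G> \<subseteq> ?B" "finite \<G>"
      then obtain K where "K \<in> ?B" "K \<subseteq> \<Inter>\<G>" using min[of \<G>] by auto
      moreover then have "K \<noteq> {}" using B(2)[of K] by (simp add: invariant_set_def)
      ultimately show "\<Inter>\<G> \<noteq> {}" by auto
    qed
    obtain K0 where K0: "K0 \<in> ?B" using ne by auto
    have "bounded K0" by (rule bounded_subset[OF C(2) B(1)[OF K0]])
    with cc fip _ _ K0 have "\<exists>w. \<forall>K\<in>?B. w \<in> K"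
      by (rule convex_compactD) (use B(2) in \<open>auto simp: invariant_set_def\<close>)
    then have "\<Inter>?B \<noteq> {}" by auto
    moreover have "closed (\<Inter>?B)"
      by (rule closed_Inter) (use B(2) in \<open>simp add: invariant_set_def\<close>)
    moreover have "convex (\<Inter>?B)"
      by (rule convex_Inter) (use B(2) in \<open>simp add: invariant_set_def\<close>)
    moreover have "T ` \<Inter>?B \<subseteq> \<Inter>?B"
    proof (intro image_subsetI InterI)
      fix x L assume x: "x \<in> \<Inter>?B" and L: "L \<in> ?B"
      from x L have "x \<in> L" by (rule InterD)
      with B(2)[OF L] show "T x \<in> L" by (auto simp: invariant_set_def)
    qed
    moreover have "\<Inter>?B \<subseteq> C" using Inter_lower[OF K0] B(1)[OF K0] by (rule subset_trans)
    ultimately have "\<Inter>?B \<in> {K. K \<subseteq> C \<and> invariant_set T K}" by (simp add: invariant_set_def)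
    moreover have "\<Union>\<C> = - \<Inter>?B" by auto
    ultimately show "\<Union>\<C> \<in> ?A" by (rule rev_image_eqI)
  qed
  then obtain M where "M \<in> ?A" and M: "\<forall>X\<in>?A. M \<subseteq> X \<longrightarrow> X = M" ..
  then obtain K where K: "M = - K" "K \<subseteq> C" "invariant_set T K" by auto
  have "L = K" if "L \<subseteq> K" "invariant_set T L" for L
  proof -
    have "- L \<in> ?A" using that K(2) by auto
    then have "- L = - K" using M K(1) that(1) by (metis Compl_subset_Compl_iff)
    then show ?thesis by simp
  qed
  then show thesis using K by (intro that[of K]) (auto simp: minimal_invariant_def)
qed

section \<open>Equivalent norms and nonexpansive maps\<close>

text \<open>Two norms are in play: closedness, weak limits and convex compactness refer to the norm
  of the type, nonexpansiveness and diameters to \<open>N\<close>. Equivalence with constant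
  \<open>k\<close> lets facts move between them.\<close>

locale renorming =
  fixes N :: "'v::banach \<Rightarrow> real" and k :: real
  assumes N_triangle: "N (x + y) \<le> N x + N y" and N_scale: "N (c *\<^sub>R x) = \<bar>c\<bar> * N x"
    and N_lower: "norm x \<le> k * N x" and N_upper: "N x \<le> k * norm x" and k_pos: "0 < k"
begin

lemma N_nonneg: "0 \<le> N x"
proof -
  have "0 \<le> k * N x" using norm_ge_zero[of x] N_lower[of x] by linarith
  then show ?thesis using k_pos by (simp add: zero_le_mult_iff)
qed

lemma N_minus [simp]: "N (- x) = N x"
  using N_scale[of "-1" x] by simp

lemma N_commute: "N (x - y) = N (y - x)"
  using N_minus[of "x - y"] by simp

lemma N_triangle_diff: "N (x - z) \<le> N (x - y) + N (y - z)"
  using N_triangle[of "x - y" "y - z"] by simp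

lemma N_convex_comb:
  assumes "0 \<le> a" "0 \<le> b"
  shows "N (a *\<^sub>R x + b *\<^sub>R y) \<le> a * N x + b * N y"
  using N_triangle[of "a *\<^sub>R x" "b *\<^sub>R y"] assms by (simp add: N_scale)

lemma lipschitz_continuous:
  assumes "\<And>u v. f u \<le> f v + N (u - v)"
  shows "continuous_on UNIV (f :: 'v \<Rightarrow> real)"
  unfolding continuous_on_iff
proof (intro ballI allI impI)
  fix v and e :: real assume e: "0 < e"
  have "dist (f u) (f v) < e" if "dist u v < e / k" for u
  proof -
    have "k * norm (u - v) < e" using that k_pos by (simp add: dist_norm field_simps)
    then show ?thesis
      using assms[of u v] assms[of v u] N_upper[of "u - v"] N_commute[of u v]
      by (simp add: dist_real_def)
  qed
  then show "\<exists>d>0. \<forall>u\<in>UNIV. dist u v < d \<longrightarrow> dist (f u) (f v) < e"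
    using e k_pos by (intro exI[of _ "e / k"]) simp
qed

lemma N_diff_continuous: "continuous_on UNIV (\<lambda>y. N (y - x))"
proof (rule lipschitz_continuous)
  show "N (u - x) \<le> N (v - x) + N (u - v)" for u v
    using N_triangle_diff[of u x v] by simp
qed

lemma N_diff_convex: "convex_on UNIV (\<lambda>y. N (y - x))"
  unfolding convex_on_def
proof (intro conjI ballI allI impI)
  fix u v and a b :: real assume ab: "0 \<le> a" "0 \<le> b" "a + b = 1"
  have "a *\<^sub>R (u - x) + b *\<^sub>R (v - x) = a *\<^sub>R u + b *\<^sub>R v - (a + b) *\<^sub>R x"
    by (simp add: algebra_simps)
  then show "N (a *\<^sub>R u + b *\<^sub>R v - x) \<le> a * N (u - x) + b * N (v - x)"
    using N_convex_comb[OF ab(1,2), of "u - x" "v - x"] ab(3) by simp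
qed simp

lemma N_ball: "closed {y. N (y - x) \<le> s}" "convex {y. N (y - x) \<le> s}"
proof -
  show "closed {y. N (y - x) \<le> s}"
    using closed_Collect_le[OF N_diff_continuous continuous_on_const] by simp
  show "convex {y. N (y - x) \<le> s}"
  proof (rule convexI)
    fix u v and a b :: real
    assume *: "u \<in> {y. N (y - x) \<le> s}" "v \<in> {y. N (y - x) \<le> s}" "0 \<le> a" "0 \<le> b" "a + b = 1"
    have "N (a *\<^sub>R u + b *\<^sub>R v - x) \<le> a * N (u - x) + b * N (v - x)"
      using N_diff_convex[of x] * unfolding convex_on_def by simp
    also have "\<dots> \<le> s" using * by (intro convex_bound_le) auto
    finally show "a *\<^sub>R u + b *\<^sub>R v \<in> {y. N (y - x) \<le> s}" by simp
  qed
qed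

end

locale nonexpansive_minimal = renorming N k for N :: "'v::banach \<Rightarrow> real" and k +
  fixes T :: "'v \<Rightarrow> 'v" and K :: "'v set" and d :: real
  assumes cc: "convex_compact TYPE('v)"
    and min: "minimal_invariant T K" and bounded: "bounded K"
    and nonexpansive: "\<And>x y. x \<in> K \<Longrightarrow> y \<in> K \<Longrightarrow> N (T x - T y) \<le> N (x - y)"
    and diam: "\<And>x y. x \<in> K \<Longrightarrow> y \<in> K \<Longrightarrow> N (x - y) \<le> d"
    and diam_least: "\<And>s. (\<And>x y. x \<in> K \<Longrightarrow> y \<in> K \<Longrightarrow> N (x - y) \<le> s) \<Longrightarrow> d \<le> s"
    and diam_pos: "0 < d"
begin

lemma K: "K \<noteq> {}" "closed K" "convex K" and T_K: "x \<in> K \<Longrightarrow> T x \<in> K"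
  using min by (auto simp: minimal_invariant_def invariant_set_def)

lemma minimalD: "L \<subseteq> K \<Longrightarrow> L \<noteq> {} \<Longrightarrow> closed L \<Longrightarrow> convex L \<Longrightarrow> (\<And>x. x \<in> L \<Longrightarrow> T x \<in> L) \<Longrightarrow> L = K"
  using min by (auto simp: minimal_invariant_def invariant_set_def)

text \<open>The hull lies in \<open>K\<close>, so \<open>T\<close> maps it into \<open>T\<close>
  K\<open>and thus into itself; minimality does the rest. It allows a bound by a ball to be checked
  on\<close>T \<open>K\<close> only.\<close>

lemma hull_image: "closure (convex hull (T ` K)) = K"
proof (rule minimalD)
  have "convex hull (T ` K) \<subseteq> K" by (rule hull_minimal) (use T_K K in auto)
  then show sub: "closure (convex hull (T ` K)) \<subseteq> K" by (rule closure_minimal) (rule K)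
  show "closure (convex hull (T ` K)) \<noteq> {}" using K(1) by simp
  show "T x \<in> closure (convex hull (T ` K))" if "x \<in> closure (convex hull (T ` K))" for x
  proof -
    have "T x \<in> T ` K" using that sub by auto
    then show ?thesis using hull_subset[of "T ` K" convex] closure_subset by blast
  qed
qed (simp_all add: convex_closure)

text \<open>If approximate fixed points stayed closer to \<open>x\<close> than
  \<open>d - \<epsilon>\<close>, minimality would spread the bound from \<open>x\<close> to all of
  \<open>K\<close>, and a second use of minimality would push the diameter below \<open>d\<close>.
  The form with one \<open>\<delta>\<close> for all \<open>z\<close> is chosen so that a whole
  sequence can later share one resolvent parameter.\<close>

lemma goebel_karlovitz:
  assumes x: "x \<in> K" and \<epsilon>: "0 < \<epsilon>"
  shows "\<exists>\<delta>>0. \<forall>z\<in>K. N (T z - z) \<le> \<delta> \<longrightarrow> d - \<epsilon> \<le> N (z - x)"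
proof (rule ccontr)
  assume neg: "\<not> ?thesis"
  have "\<exists>z. z \<in> K \<and> N (T z - z) \<le> inverse (real (Suc n)) \<and> N (z - x) < d - \<epsilon>" for n
  proof -
    have "0 < inverse (real (Suc n))" by simp
    then show ?thesis using neg by (meson not_le)
  qed
  then obtain z where z: "\<And>n. z n \<in> K" "\<And>n. N (T (z n) - z n) \<le> inverse (real (Suc n))"
    "\<And>n. N (z n - x) < d - \<epsilon>" by metis
  obtain U where U: "U \<le> sequentially" "ultra U" by (rule ultra_exists[OF sequentially_bot])
  have nb: "U \<noteq> bot" using U(2) by (simp add: ultra_def)
  have zero: "((\<lambda>n. N (T (z n) - z n)) \<longlongrightarrow> 0) U"
    by (rule tendsto_mono[OF U(1)],
        rule tendsto_sandwich[OF _ _ tendsto_const LIMSEQ_inverse_real_of_nat])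
      (use z(2) N_nonneg in auto)
  define \<phi> where "\<phi> y = Lim U (\<lambda>n. N (z n - y))" for y
  have lim: "((\<lambda>n. N (z n - y)) \<longlongrightarrow> \<phi> y) U" for y
    unfolding \<phi>_def
  proof (rule ultra_tendsto_Lim[OF U(2)])
    have "\<bar>N (z n - y)\<bar> \<le> d + N (x - y)" for n
      using N_nonneg[of "z n - y"] N_triangle_diff[of "z n" y x] diam[OF z(1)[of n] x] by simp
    then show "\<forall>\<^sub>F n in U. \<bar>N (z n - y)\<bar> \<le> d + N (x - y)" by simp
  qed
  have lip: "\<phi> u \<le> \<phi> v + N (u - v)" for u v
  proof (rule tendsto_le[OF nb _ lim])
    show "((\<lambda>n. N (z n - v) + N (u - v)) \<longlongrightarrow> \<phi> v + N (u - v)) U" by (intro tendsto_intros lim)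
    have "N (z n - u) \<le> N (z n - v) + N (u - v)" for n
      using N_triangle_diff[of "z n" u v] N_commute[of u v] by simp
    then show "\<forall>\<^sub>F n in U. N (z n - u) \<le> N (z n - v) + N (u - v)" by simp
  qed
  have convex: "\<phi> (a *\<^sub>R u + b *\<^sub>R v) \<le> a * \<phi> u + b * \<phi> v" if ab: "0 \<le> a" "0 \<le> b" "a + b = 1"
    for u v a b
  proof (rule tendsto_le[OF nb _ lim])
    show "((\<lambda>n. a * N (z n - u) + b * N (z n - v)) \<longlongrightarrow> a * \<phi> u + b * \<phi> v) U"
      by (intro tendsto_intros lim)
    have "N (z n - (a *\<^sub>R u + b *\<^sub>R v)) \<le> a * N (z n - u) + b * N (z n - v)" for n
      using N_diff_convex[of "z n"] ab unfolding convex_on_def N_commute[of "z n"] by simp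
    then show "\<forall>\<^sub>F n in U. N (z n - (a *\<^sub>R u + b *\<^sub>R v)) \<le> a * N (z n - u) + b * N (z n - v)"
      by simp
  qed
  have T_le: "\<phi> (T y) \<le> \<phi> y" if y: "y \<in> K" for y
  proof (rule tendsto_le[OF nb _ lim])
    show "((\<lambda>n. N (T (z n) - z n) + N (z n - y)) \<longlongrightarrow> \<phi> y) U"
      using tendsto_add[OF zero lim[of y]] by simp
    have "N (z n - T y) \<le> N (T (z n) - z n) + N (z n - y)" for n
      using N_triangle_diff[of "z n" "T y" "T (z n)"] N_commute[of "z n" "T (z n)"]
        nonexpansive[OF z(1)[of n] y] by simp
    then show "\<forall>\<^sub>F n in U. N (z n - T y) \<le> N (T (z n) - z n) + N (z n - y)" by simp
  qed
  \<comment> \<open>The sublevel set of \<open>\<phi>\<close> at height \<open>\<phi> x\<close> is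
    invariant by \<open>T_le\<close>, hence is all of \<open>K\<close>.\<close>
  have const: "\<phi> y \<le> \<phi> x" if y: "y \<in> K" for y
  proof -
    have "{y \<in> K. \<phi> y \<le> \<phi> x} = K"
    proof (rule minimalD)
      show "{y \<in> K. \<phi> y \<le> \<phi> x} \<noteq> {}" using x by auto
      have "{y \<in> K. \<phi> y \<le> \<phi> x} = K \<inter> {y. \<phi> y \<le> \<phi> x}" by auto
      then show "closed {y \<in> K. \<phi> y \<le> \<phi> x}"
        using closed_Collect_le[OF lipschitz_continuous[OF lip] continuous_on_const] K(2) by auto
      show "convex {y \<in> K. \<phi> y \<le> \<phi> x}"
      proof (rule convexI)
        fix u v and a b :: real
        assume *: "u \<in> {y \<in> K. \<phi> y \<le> \<phi> x}" "v \<in> {y \<in> K. \<phi> y \<le> \<phi> x}" "0 \<le> a" "0 \<le> b" "a + b = 1"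
        have "\<phi> (a *\<^sub>R u + b *\<^sub>R v) \<le> a * \<phi> u + b * \<phi> v" using convex * by simp
        also have "\<dots> \<le> \<phi> x" using * by (intro convex_bound_le) auto
        finally show "a *\<^sub>R u + b *\<^sub>R v \<in> {y \<in> K. \<phi> y \<le> \<phi> x}"
          using convexD[OF K(3)] * by simp
      qed
      show "T y \<in> {y \<in> K. \<phi> y \<le> \<phi> x}" if "y \<in> {y \<in> K. \<phi> y \<le> \<phi> x}" for y
        using that T_le[of y] T_K[of y] by simp
    qed simp
    then show ?thesis using y by auto
  qed
  have s: "\<phi> x \<le> d - \<epsilon>"
    by (rule tendsto_upperbound[OF lim _ nb], rule always_eventually) (intro allI less_imp_le z(3))
  obtain B where B: "\<And>y. y \<in> K \<Longrightarrow> norm y \<le> B" using bounded unfolding bounded_iff by auto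
  have zB: "\<forall>\<^sub>F n in U. norm (z n) \<le> B" using B z(1) by simp
  obtain v where v: "weak_lim U z v" by (rule weak_lim_exists[OF cc nb zB])
  have vK: "v \<in> K" by (rule weak_limD[OF v K(2,3)]) (simp add: z)
  have v_le: "N (v - y) \<le> \<phi> x" if "y \<in> K" for y
    using weak_lim_convex_le[OF v nb N_diff_convex N_diff_continuous lim[of y]] const[OF that]
      by simp
  let ?L = "K \<inter> (\<Inter>y\<in>K. {w. N (w - y) \<le> \<phi> x})"
  have "?L = K"
  proof (rule minimalD)
    show "?L \<noteq> {}" using vK v_le by auto
    show "closed ?L" using K(2) N_ball by (intro closed_Int closed_INT) auto
    show "convex ?L" using K(3) N_ball by (intro convex_Int convex_INT) auto
    show "T w \<in> ?L" if w: "w \<in> ?L" for w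
    proof -
      have "T ` K \<subseteq> {u. N (u - T w) \<le> \<phi> x}"
      proof (rule image_subsetI)
        fix y assume y: "y \<in> K"
        have "N (T y - T w) \<le> N (w - y)" using nonexpansive[of y w] y w N_commute[of y w] by simp
        also have "\<dots> \<le> \<phi> x" using w y by auto
        finally show "T y \<in> {u. N (u - T w) \<le> \<phi> x}" by simp
      qed
      then have "convex hull (T ` K) \<subseteq> {u. N (u - T w) \<le> \<phi> x}" by (rule hull_minimal) (rule N_ball)
      then have "closure (convex hull (T ` K)) \<subseteq> {u. N (u - T w) \<le> \<phi> x}"
        by (rule closure_minimal) (rule N_ball)
      then have "N (T w - y) \<le> \<phi> x" if "y \<in> K" for y
        using that unfolding hull_image N_commute[of "T w"] by auto
      then show ?thesis using w T_K by auto
    qed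
  qed simp
  then have "N (a - b) \<le> \<phi> x" if "a \<in> K" "b \<in> K" for a b using that by auto
  then have "d \<le> \<phi> x" by (rule diam_least)
  then show False using s \<epsilon> by simp
qed

section \<open>Resolvents and approximate fixed points\<close>

text \<open>The map \<open>f\<close> contracts \<open>N\<close> by the factor
  \<open>1 - \<delta>\<close>, but not necessarily the norm of the type, for which the Banach
  principle is applied; a high iterate of \<open>f\<close> contracts that norm too.\<close>

lemma resolvent_exists:
  assumes p: "p \<in> K" and \<delta>: "0 < \<delta>" "\<delta> < 1"
  shows "\<exists>z\<in>K. z = (1 - \<delta>) *\<^sub>R T z + \<delta> *\<^sub>R p"
proof -
  define f where "f z = (1 - \<delta>) *\<^sub>R T z + \<delta> *\<^sub>R p" for z
  have f_K: "f z \<in> K" if "z \<in> K" for z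
    unfolding f_def using convexD[OF K(3) T_K[OF that] p, of "1 - \<delta>" \<delta>] \<delta> by simp
  have f_contr: "N (f x - f y) \<le> (1 - \<delta>) * N (x - y)" if "x \<in> K" "y \<in> K" for x y
  proof -
    have "f x - f y = (1 - \<delta>) *\<^sub>R (T x - T y)" by (simp add: f_def scaleR_diff_right)
    then show ?thesis using nonexpansive[OF that] \<delta> by (simp add: N_scale mult_left_mono)
  qed
  have pow_K: "(f ^^ n) x \<in> K" if "x \<in> K" for x n
    using that by (induction n) (simp_all add: f_K)
  have pow_contr: "N ((f ^^ n) x - (f ^^ n) y) \<le> (1 - \<delta>) ^ n * N (x - y)" if xy: "x \<in> K" "y \<in> K"
    for x y n
  proof (induction n)
    case (Suc n)
    have "N ((f ^^ Suc n) x - (f ^^ Suc n) y) \<le> (1 - \<delta>) * N ((f ^^ n) x - (f ^^ n) y)"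
      using f_contr[OF pow_K[OF xy(1)] pow_K[OF xy(2)]] by simp
    also have "\<dots> \<le> (1 - \<delta>) * ((1 - \<delta>) ^ n * N (x - y))"
      using Suc \<delta> by (intro mult_left_mono) auto
    finally show ?case by simp
  qed simp
  \<comment> \<open>Passing from the norm to \<open>N\<close> and back costs \<open>k\<close> each
    time, so this threshold leaves a contraction factor of 1/2.\<close>
  have "0 < 1 / (2 * k * k)" using k_pos by simp
  then obtain n where n: "(1 - \<delta>) ^ n < 1 / (2 * k * k)"
    using real_arch_pow_inv[of "1 / (2 * k * k)" "1 - \<delta>"] \<delta> by auto
  have "\<exists>!x\<in>K. (f ^^ n) x = x"
  proof (rule Banach_fix[where c = "1/2"])
    show "complete K" using K(2) by (simp add: complete_eq_closed)
    show "(f ^^ n) ` K \<subseteq> K" using pow_K by auto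
    fix x y assume xy: "x \<in> K" "y \<in> K"
    have "norm ((f ^^ n) x - (f ^^ n) y) \<le> k * N ((f ^^ n) x - (f ^^ n) y)" by (rule N_lower)
    also have "\<dots> \<le> k * ((1 - \<delta>) ^ n * (k * norm (x - y)))"
    proof (intro mult_left_mono)
      have "N ((f ^^ n) x - (f ^^ n) y) \<le> (1 - \<delta>) ^ n * N (x - y)" by (rule pow_contr[OF xy])
      also have "\<dots> \<le> (1 - \<delta>) ^ n * (k * norm (x - y))"
        using N_upper \<delta> by (intro mult_left_mono) auto
      finally show "N ((f ^^ n) x - (f ^^ n) y) \<le> (1 - \<delta>) ^ n * (k * norm (x - y))" .
    qed (use k_pos in auto)
    also have "\<dots> = (1 - \<delta>) ^ n * (k * k * norm (x - y))" by simp
    also have "\<dots> \<le> 1 / (2 * k * k) * (k * k * norm (x - y))"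
      using n k_pos by (intro mult_right_mono) auto
    also have "\<dots> = 1/2 * norm (x - y)" using k_pos by simp
    finally show "dist ((f ^^ n) x) ((f ^^ n) y) \<le> 1/2 * dist x y" by (simp add: dist_norm)
  qed (use K in auto)
  then obtain z where z: "z \<in> K \<and> (f ^^ n) z = z" and uniq: "\<forall>y. y \<in> K \<and> (f ^^ n) y = y \<longrightarrow> y = z"
    by (elim ex1E)
  \<comment> \<open>\<open>f z\<close> is fixed by the iterate as well, hence equals
    \<open>z\<close> by uniqueness.\<close>
  have "(f ^^ n) (f z) = f ((f ^^ n) z)" by (rule funpow_swap1[symmetric])
  also have "\<dots> = f z" by (simp only: conjunct2[OF z])
  finally have "f z = z" by (intro uniq[rule_format] conjI f_K conjunct1[OF z])
  then show ?thesis using conjunct1[OF z] unfolding f_def by (metis)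
qed

lemma approximate_fixed_points:
  obtains x where "\<And>n. x n \<in> K" "(\<lambda>n. N (T (x n) - x n)) \<longlonglongrightarrow> 0"
proof -
  obtain p where p: "p \<in> K" using K(1) by auto
  \<comment> \<open>The double successor keeps the parameter strictly below 1 already at
    \<open>n = 0\<close>.\<close>
  have "\<exists>z. z \<in> K \<and> z
    = (1 - inverse (real (Suc (Suc n)))) *\<^sub>R T z + inverse (real (Suc (Suc n))) *\<^sub>R p" for n
    using resolvent_exists[OF p, of "inverse (real (Suc (Suc n)))"]
      by (auto simp: inverse_less_1_iff)
  then obtain x where x: "\<And>n. x n \<in> K"
    "\<And>n. x n = (1 - inverse (real (Suc (Suc n)))) *\<^sub>R T (x n) + inverse (real (Suc (Suc n))) *\<^sub>R p"
      by metis
  have le: "N (T (x n) - x n) \<le> inverse (real (Suc (Suc n))) * d" for n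
  proof -
    have "T (x n) - x n = inverse (real (Suc (Suc n))) *\<^sub>R (T (x n) - p)"
      by (subst (2) x(2)) (simp add: algebra_simps)
    then have "N (T (x n) - x n) = inverse (real (Suc (Suc n))) * N (T (x n) - p)"
      by (simp add: N_scale)
    then show ?thesis using diam[OF T_K[OF x(1)[of n]] p] by (simp add: mult_left_mono)
  qed
  have "(\<lambda>n. inverse (real (Suc (Suc n))) * d) \<longlonglongrightarrow> 0 * d"
    by (intro tendsto_intros LIMSEQ_Suc[OF LIMSEQ_inverse_real_of_nat])
  then have null: "(\<lambda>n. inverse (real (Suc (Suc n))) * d) \<longlonglongrightarrow> 0" by simp
  have "(\<lambda>n. N (T (x n) - x n)) \<longlonglongrightarrow> 0"
    by (rule tendsto_sandwich[OF always_eventually always_eventually tendsto_const null])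
      (intro allI le N_nonneg)+
  with x(1) show thesis by (rule that)
qed

text \<open>Taking resolvents of the points \<open>w + (s / d) (x\<^sub>n - w)\<close> replaces the usual passage to a
  \<open>T\<close>-invariant subset of an ultrapower of \<open>K\<close>: both distance estimates survive the resolvent.\<close>

lemma perturbed_fixed_points:
  assumes x: "\<And>n. x n \<in> K" and w: "w \<in> K" and s: "0 < s" "s < d" and \<epsilon>: "0 < \<epsilon>"
  obtains z C where "\<And>n. z n \<in> K" "\<And>n m. N (z n - z m) \<le> s" "\<And>n. d - \<epsilon> \<le> N (z n - w)"
    "\<And>n. N (z n - x n) \<le> d - s + C * N (T (x n) - x n)"
proof -
  define c where "c = s / d"
  have c: "0 < c" "c < 1" "c * d = s" using s diam_pos by (simp_all add: c_def)
  obtain \<delta>0 where \<delta>0: "0 < \<delta>0" "\<And>z. z \<in> K \<Longrightarrow> N (T z - z) \<le> \<delta>0 \<Longrightarrow> d - \<epsilon> \<le> N (z - w)"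
    using goebel_karlovitz[OF w \<epsilon>] by auto
  \<comment> \<open>One parameter serves all \<open>n\<close>. A resolvent moves under
    \<open>T\<close> by at most \<open>\<delta> * d\<close>, so \<open>\<delta>0 / d\<close> puts
    every \<open>z n\<close> in the range of Goebel and Karlovitz; 1/2 keeps the parameter below
    1.\<close>
  define \<delta> where "\<delta> = min (1/2) (\<delta>0 / d)"
  have \<delta>: "0 < \<delta>" "\<delta> < 1" "\<delta> * d \<le> \<delta>0"
    using \<delta>0(1) diam_pos by (auto simp: \<delta>_def field_simps min_def)
  define p where "p n = (1 - c) *\<^sub>R w + c *\<^sub>R x n" for n
  have p_K: "p n \<in> K" for n
    unfolding p_def using convexD[OF K(3) w x, of "1 - c" c] c by simp
  have "\<exists>z. z \<in> K \<and> z = (1 - \<delta>) *\<^sub>R T z + \<delta> *\<^sub>R p n" for n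
    using resolvent_exists[OF p_K \<delta>(1,2)] by auto
  then obtain z where z: "\<And>n. z n \<in> K" "\<And>n. z n = (1 - \<delta>) *\<^sub>R T (z n) + \<delta> *\<^sub>R p n" by metis
  \<comment> \<open>The distance recurs on the right with factor \<open>1 - \<delta>\<close>.
    Absorbing it leaves exactly the distance of the anchors \<open>p n\<close>, \<open>p m\<close>,
    which is at most \<open>c * d = s\<close>.\<close>
  have A: "N (z n - z m) \<le> s" for n m
  proof -
    have "z n - z m = (1 - \<delta>) *\<^sub>R (T (z n) - T (z m)) + \<delta> *\<^sub>R (p n - p m)"
      by (subst z(2)[of n], subst z(2)[of m]) (simp add: algebra_simps)
    moreover have "p n - p m = c *\<^sub>R (x n - x m)" by (simp add: p_def scaleR_diff_right)
    ultimately have "N (z n - z m) \<le> (1 - \<delta>) * N (T (z n) - T (z m)) + \<delta> * (c * N (x n - x m))"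
      using N_convex_comb[of "1 - \<delta>" \<delta> "T (z n) - T (z m)" "p n - p m"] \<delta> c(1)
        by (simp add: N_scale)
    also have "\<dots> \<le> (1 - \<delta>) * N (z n - z m) + \<delta> * (c * d)"
      using \<delta> c nonexpansive[OF z(1) z(1)] diam[OF x x] by (intro add_mono mult_left_mono) auto
    finally have "\<delta> * N (z n - z m) \<le> \<delta> * s" using c(3) by (simp add: algebra_simps)
    then show ?thesis using \<delta>(1) by simp
  qed
  have B: "d - \<epsilon> \<le> N (z n - w)" for n
  proof (rule \<delta>0(2)[OF z(1)])
    have "T (z n) - z n = \<delta> *\<^sub>R (T (z n) - p n)"
      by (subst (2) z(2)) (simp add: algebra_simps)
    then have "N (T (z n) - z n) = \<delta> * N (T (z n) - p n)" using \<delta> by (simp add: N_scale)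
    also have "\<dots> \<le> \<delta> * d" using \<delta> diam[OF T_K[OF z(1)] p_K] by (intro mult_left_mono) auto
    finally show "N (T (z n) - z n) \<le> \<delta>0" using \<delta>(3) by simp
  qed
  \<comment> \<open>The constant \<open>1 / \<delta>\<close> may be large but does not depend on
    \<open>n\<close>, so the error vanishes when the \<open>x n\<close> are approximate fixed
    points.\<close>
  have D: "N (z n - x n) \<le> d - s + 1 / \<delta> * N (T (x n) - x n)" for n
  proof -
    let ?\<eta> = "N (T (x n) - x n)"
    have "z n - x n = (1 - \<delta>) *\<^sub>R (T (z n) - x n) + \<delta> *\<^sub>R (p n - x n)"
      by (subst z(2)[of n]) (simp add: algebra_simps)
    moreover have "p n - x n = (1 - c) *\<^sub>R (w - x n)" by (simp add: p_def algebra_simps)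
    ultimately have "N (z n - x n) \<le> (1 - \<delta>) * N (T (z n) - x n) + \<delta> * ((1 - c) * N (w - x n))"
      using N_convex_comb[of "1 - \<delta>" \<delta> "T (z n) - x n" "p n - x n"] \<delta> c(1,2) by (simp add: N_scale)
    also have "\<dots> \<le> (1 - \<delta>) * (N (z n - x n) + ?\<eta>) + \<delta> * ((1 - c) * d)"
    proof (intro add_mono mult_left_mono)
      show "N (T (z n) - x n) \<le> N (z n - x n) + ?\<eta>"
        using N_triangle_diff[of "T (z n)" "x n" "T (x n)"] nonexpansive[OF z(1)[of n] x[of n]]
          by simp
      show "N (w - x n) \<le> d" by (rule diam[OF w x])
    qed (use \<delta> c in auto)
    also have "(1 - c) * d = d - s" using c(3) by (simp add: algebra_simps)
    finally have "\<delta> * N (z n - x n) \<le> (1 - \<delta>) * ?\<eta> + \<delta> * (d - s)" by (simp add: algebra_simps)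
    also have "(1 - \<delta>) * ?\<eta> \<le> 1 * ?\<eta>" using \<delta> N_nonneg by (intro mult_right_mono) auto
    finally show ?thesis using \<delta>(1) by (simp add: field_simps)
  qed
  show thesis by (rule that[OF z(1) A B D])
qed

end

section \<open>Direct sums\<close>

lemma weak_lim_norm_le:
  assumes "weak_lim F x w" "F \<noteq> bot" "((\<lambda>n. norm (x n)) \<longlongrightarrow> l) F"
  shows "norm w \<le> l"
proof (rule weak_lim_convex_le[OF assms(1,2) _ _ assms(3)])
  show "convex_on UNIV (norm :: 'b \<Rightarrow> real)" using convex_on_dist[of UNIV "0 :: 'b"] by simp
qed (intro continuous_intros)

lemma ultra_tendsto_norm_diff:
  assumes "ultra U" "\<And>n. norm (x n) \<le> M" "\<And>n. norm (y n) \<le> M'"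
  shows "((\<lambda>n. norm (x n - y n)) \<longlongrightarrow> Lim U (\<lambda>n. norm (x n - y n))) U"
proof (rule ultra_tendsto_norm[OF assms(1)])
  show "norm (x n - y n) \<le> M + M'" for n
    using norm_triangle_ineq4[of "x n" "y n"] assms(2)[of n] assms(3)[of n] by linarith
qed

text \<open>The joint weak limit transfers through subtraction, so \<open>z n - x n\<close> tends
  weakly to \<open>v - w\<close>; the second bound is the reverse triangle inequality in the
  limit.\<close>

lemma weak_lim_comparison:
  fixes x z :: "nat \<Rightarrow> 'a::real_normed_vector"
  assumes U: "ultra U" and lim: "weak_lim U (\<lambda>n. (x n, z n)) (w, v)"
    and bd: "\<And>n. norm (x n) \<le> M" "\<And>n. norm (z n) \<le> M"
  shows "norm (v - w) \<le> Lim U (\<lambda>n. norm (z n - x n))"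
    and "\<bar>Lim U (\<lambda>n. norm (x n - w)) - Lim U (\<lambda>n. norm (z n - w))\<bar> \<le> Lim U (\<lambda>n. norm (z n - x n))"
proof -
  have nb: "U \<noteq> bot" using U by (simp add: ultra_def)
  have "bounded_linear (\<lambda>p :: 'a \<times> 'a. snd p - fst p)"
    by (intro bounded_linear_sub bounded_linear_fst bounded_linear_snd)
  then have "weak_lim U (\<lambda>n. snd (x n, z n) - fst (x n, z n)) (snd (w, v) - fst (w, v))"
    by (rule weak_lim_linear[OF lim])
  then have "weak_lim U (\<lambda>n. z n - x n) (v - w)" by simp
  then show "norm (v - w) \<le> Lim U (\<lambda>n. norm (z n - x n))"
    by (rule weak_lim_norm_le[OF _ nb ultra_tendsto_norm_diff[OF U bd(2,1)]])
  have le: "\<bar>norm (x n - w) - norm (z n - w)\<bar> \<le> norm (z n - x n)" for n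
    using norm_triangle_ineq3[of "x n - w" "z n - w"] by (simp add: norm_minus_commute)
  show "\<bar>Lim U (\<lambda>n. norm (x n - w)) - Lim U (\<lambda>n. norm (z n - w))\<bar> \<le> Lim U (\<lambda>n. norm (z n - x n))"
  proof (rule tendsto_le[OF nb])
    show "((\<lambda>n. norm (z n - x n)) \<longlongrightarrow> Lim U (\<lambda>n. norm (z n - x n))) U"
      by (rule ultra_tendsto_norm_diff[OF U bd(2,1)])
    show "((\<lambda>n. \<bar>norm (x n - w) - norm (z n - w)\<bar>) \<longlongrightarrow>
        \<bar>Lim U (\<lambda>n. norm (x n - w)) - Lim U (\<lambda>n. norm (z n - w))\<bar>) U"
      by (intro tendsto_rabs tendsto_diff ultra_tendsto_norm_diff[OF U bd(1) order_refl]
          ultra_tendsto_norm_diff[OF U bd(2) order_refl])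
  qed (simp add: le)
qed

section \<open>Absolute normalized norms on the plane\<close>

locale absolute_norm =
  fixes \<psi> :: "real \<times> real \<Rightarrow> real"
  assumes absolute_normalized: "absolute_normalized_norm \<psi>"
begin

lemma psi_nonneg: "0 \<le> \<psi> p"
  and psi_zero_pair: "\<psi> p = 0 \<longleftrightarrow> p = (0, 0)"
  and psi_scale: "\<psi> (t * a, t * b) = \<bar>t\<bar> * \<psi> (a, b)"
  and psi_triangle: "\<psi> (a + c, b + e) \<le> \<psi> (a, b) + \<psi> (c, e)"
  and psi_abs: "\<psi> (a, b) = \<psi> (\<bar>a\<bar>, \<bar>b\<bar>)"
  and psi_unit: "\<psi> (1, 0) = 1" "\<psi> (0, 1) = 1"
  using absolute_normalized unfolding absolute_normalized_norm_def is_norm_R2_def by iprover+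

lemma psi_zero: "\<psi> (a, b) = 0 \<longleftrightarrow> a = 0 \<and> b = 0"
  using psi_zero_pair[of "(a, b)"] by simp

lemma psi_fst: "\<psi> (a, 0) = \<bar>a\<bar>"
  using psi_scale[of a 1 0] psi_unit by simp

lemma psi_snd: "\<psi> (0, b) = \<bar>b\<bar>"
  using psi_scale[of b 0 1] psi_unit by simp

lemma psi_neg_fst: "\<psi> (- a, b) = \<psi> (a, b)"
  using psi_abs[of "- a" b] psi_abs[of a b] by simp

lemma psi_neg_snd: "\<psi> (a, - b) = \<psi> (a, b)"
  using psi_abs[of a "- b"] psi_abs[of a b] by simp

lemma psi_ge: "\<bar>a\<bar> \<le> \<psi> (a, b)" "\<bar>b\<bar> \<le> \<psi> (a, b)"
proof -
  have "\<psi> (2 * a, 0) \<le> \<psi> (a, b) + \<psi> (a, b)"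
    using psi_triangle[of a a b "- b"] by (simp add: psi_neg_snd)
  then show "\<bar>a\<bar> \<le> \<psi> (a, b)" by (simp add: psi_fst)
  have "\<psi> (0, 2 * b) \<le> \<psi> (a, b) + \<psi> (a, b)"
    using psi_triangle[of a "- a" b b] by (simp add: psi_neg_fst)
  then show "\<bar>b\<bar> \<le> \<psi> (a, b)" by (simp add: psi_snd)
qed

lemma psi_le_sum: "\<psi> (a, b) \<le> \<bar>a\<bar> + \<bar>b\<bar>"
  using psi_triangle[of a 0 0 b] by (simp add: psi_fst psi_snd)

text \<open>For \<open>t\<close> between 0 and 1, \<open>t * a\<close> is a convex combination of
  \<open>a\<close> and \<open>- a\<close>, and \<open>\<psi>\<close> does not see the sign.\<close>

lemma psi_mono:
  assumes "0 \<le> a" "a \<le> a'" "0 \<le> b" "b \<le> b'"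
  shows "\<psi> (a, b) \<le> \<psi> (a', b')"
proof -
  have *: "\<psi> (t * a, b) \<le> \<psi> (a, b)" "\<psi> (b, t * a) \<le> \<psi> (b, a)" if t: "0 \<le> t" "t \<le> 1"
    for t a b :: real
  proof -
    have e: "t * a = (1 + t) / 2 * a + (1 - t) / 2 * (- a)" "b = (1 + t) / 2 * b + (1 - t) / 2 * b"
      by (simp_all add: field_simps)
    have s: "\<bar>(1 + t) / 2\<bar> = (1 + t) / 2" "\<bar>(1 - t) / 2\<bar> = (1 - t) / 2" using t by auto
    have r: "(1 + t) / 2 * y + (1 - t) / 2 * y = y" for y :: real by (simp add: field_simps)
    have "\<psi> (t * a, b)
      = \<psi> ((1 + t) / 2 * a + (1 - t) / 2 * (- a), (1 + t) / 2 * b + (1 - t) / 2 * b)"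
      using e by simp
    also have "\<dots> \<le> (1 + t) / 2 * \<psi> (a, b) + (1 - t) / 2 * \<psi> (a, b)"
      using psi_triangle[of "(1 + t) / 2 * a" "(1 - t) / 2 * (- a)" "(1 + t) / 2 * b"
        "(1 - t) / 2 * b"]
      unfolding psi_scale psi_neg_fst s .
    finally show "\<psi> (t * a, b) \<le> \<psi> (a, b)" unfolding r .
    have "\<psi> (b, t * a)
      = \<psi> ((1 + t) / 2 * b + (1 - t) / 2 * b, (1 + t) / 2 * a + (1 - t) / 2 * (- a))"
      using e by simp
    also have "\<dots> \<le> (1 + t) / 2 * \<psi> (b, a) + (1 - t) / 2 * \<psi> (b, a)"
      using psi_triangle[of "(1 + t) / 2 * b" "(1 - t) / 2 * b" "(1 + t) / 2 * a"
        "(1 - t) / 2 * (- a)"]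
      unfolding psi_scale psi_neg_snd s .
    finally show "\<psi> (b, t * a) \<le> \<psi> (b, a)" unfolding r .
  qed
  have div: "\<exists>t. 0 \<le> t \<and> t \<le> 1 \<and> c = t * c'" if "0 \<le> c" "c \<le> c'" for c c' :: real
    using that by (cases "c' = 0") (auto intro!: exI[of _ "c / c'"])
  obtain t where t: "0 \<le> t" "t \<le> 1" "a = t * a'" using div[OF assms(1,2)] by auto
  obtain u where u: "0 \<le> u" "u \<le> 1" "b = u * b'" using div[OF assms(3,4)] by auto
  have "\<psi> (a, b) \<le> \<psi> (a', b)" using *(1)[OF t(1,2)] t(3) by simp
  also have "\<dots> \<le> \<psi> (a', b')" using *(2)[OF u(1,2)] u(3) by simp
  finally show ?thesis .
qed

lemma psi_diff: "\<bar>\<psi> (a, b) - \<psi> (a', b')\<bar> \<le> \<bar>a - a'\<bar> + \<bar>b - b'\<bar>"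
  using psi_triangle[of a' "a - a'" b' "b - b'"] psi_triangle[of a "a' - a" b "b' - b"]
    psi_le_sum[of "a - a'" "b - b'"] psi_le_sum[of "a' - a" "b' - b"] by simp

lemma psi_tendsto:
  assumes f: "(f \<longlongrightarrow> a) F" and g: "(g \<longlongrightarrow> b) F"
  shows "((\<lambda>n. \<psi> (f n, g n)) \<longlongrightarrow> \<psi> (a, b)) F"
proof (rule LIM_zero_cancel, rule Lim_null_comparison)
  show "\<forall>\<^sub>F n in F. norm (\<psi> (f n, g n) - \<psi> (a, b)) \<le> \<bar>f n - a\<bar> + \<bar>g n - b\<bar>"
    by (simp add: psi_diff)
  have "((\<lambda>n. \<bar>f n - a\<bar> + \<bar>g n - b\<bar>) \<longlongrightarrow> \<bar>a - a\<bar> + \<bar>b - b\<bar>) F"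
    by (intro tendsto_intros f g)
  then show "((\<lambda>n. \<bar>f n - a\<bar> + \<bar>g n - b\<bar>) \<longlongrightarrow> 0) F" by simp
qed

text \<open>A hyperplane separates \<open>(a, b)\<close> from the open ball of radius
  \<open>\<psi> (a, b)\<close>. Absoluteness allows its coefficients to be replaced by their
  absolute values.\<close>

lemma support_functional:
  assumes nonneg: "0 \<le> a" "0 \<le> b"
  shows "\<exists>f g. 0 \<le> f \<and> f \<le> 1 \<and> 0 \<le> g \<and> g \<le> 1 \<and> f * a + g * b = \<psi> (a, b) \<and>
    (\<forall>x\<ge>0. \<forall>y\<ge>0. f * x + g * y \<le> \<psi> (x, y))"
proof (cases "a = 0 \<and> b = 0")
  case True
  then show ?thesis using psi_nonneg psi_zero[of 0 0] by (intro exI[of _ 0]) simp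
next
  case False
  let ?r = "\<psi> (a, b)"
  have r: "0 < ?r" using False psi_nonneg[of "(a, b)"] psi_zero[of a b] by linarith
  let ?S = "{p. \<psi> p < ?r}"
  have "convex ?S"
  proof (rule convexI)
    fix p q and u v :: real assume *: "p \<in> ?S" "q \<in> ?S" "0 \<le> u" "0 \<le> v" "u + v = 1"
    have "\<psi> (u *\<^sub>R p + v *\<^sub>R q) \<le> u * \<psi> p + v * \<psi> q"
      using psi_triangle[of "u * fst p" "v * fst q" "u * snd p" "v * snd q"] *(3,4)
        psi_scale[of u "fst p" "snd p"] psi_scale[of v "fst q" "snd q"]
      by (simp add: plus_prod_def scaleR_prod_def)
    also have "\<dots> < ?r" using * by (intro convex_bound_lt) auto
    finally show "u *\<^sub>R p + v *\<^sub>R q \<in> ?S" by simp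
  qed
  moreover have "(0, 0) \<in> ?S" using r psi_zero[of 0 0] by simp
  then have "?S \<noteq> {}" by (metis empty_iff)
  ultimately have "\<exists>h c. h \<noteq> 0 \<and> (\<forall>p\<in>?S. h \<bullet> p \<le> c) \<and> (\<forall>p\<in>{(a, b)}. c \<le> h \<bullet> p)"
    by (intro separating_hyperplane_sets) simp_all
  then obtain h c where h: "h \<noteq> 0" "\<forall>p\<in>?S. h \<bullet> p \<le> c" "c \<le> h \<bullet> (a, b)"
    by (elim exE conjE) simp
  obtain h1 h2 where h12: "h = (h1, h2)" by (cases h)
  let ?m = "h1 * a + h2 * b"
  have S_le: "h1 * x + h2 * y \<le> ?m" if "\<psi> (x, y) < ?r" for x y
    using h(2,3) that unfolding h12 by fastforce
  have m: "0 < ?m"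
  proof -
    \<comment> \<open>A small multiple of \<open>h\<close> itself lies in the ball, and
      \<open>h\<close> is positive there, so its value at \<open>(a, b)\<close> is positive and can
      be normalized.\<close>
    define H where "H = \<bar>h1\<bar> + \<bar>h2\<bar>"
    define l where "l = ?r / (2 * H)"
    have hpos: "0 < H" using h(1) h12 by (auto simp: zero_prod_def H_def)
    have l: "0 < l" using r hpos by (simp add: l_def)
    have "\<psi> (l * h1, l * h2) \<le> l * H"
      using psi_le_sum[of "l * h1" "l * h2"] l by (simp add: abs_mult algebra_simps H_def)
    also have "\<dots> < ?r" using r hpos by (simp add: l_def)
    finally have "h1 * (l * h1) + h2 * (l * h2) \<le> ?m" by (rule S_le)
    moreover have "0 < l * (h1 * h1 + h2 * h2)"
      using l hpos by (intro mult_pos_pos) (auto simp: sum_squares_gt_zero_iff H_def)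
    ultimately show ?thesis by (simp add: algebra_simps)
  qed
  define e where "e = ?r / ?m"
  have e: "0 < e" "e * ?m = ?r" using r m by (simp_all add: e_def)
  have le: "e * (h1 * x + h2 * y) \<le> \<psi> (x, y)" for x y
  proof (rule ccontr)
    let ?q = "h1 * x + h2 * y"
    assume "\<not> ?thesis"
    then have "\<psi> (x, y) < e * ?q" by simp
    then obtain t where t: "\<psi> (x, y) < t" "t < e * ?q" using dense by auto
    have tpos: "0 < t" using t(1) psi_nonneg[of "(x, y)"] by linarith
    have "\<psi> ((?r / t) * x, (?r / t) * y) = ?r / t * \<psi> (x, y)"
      using psi_scale[of "?r / t" x y] r tpos by simp
    also have "\<dots> < ?r / t * t" using t(1) tpos r by (intro mult_strict_left_mono) auto
    also have "\<dots> = ?r" using tpos by simp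
    finally have "h1 * ((?r / t) * x) + h2 * ((?r / t) * y) \<le> ?m" by (rule S_le)
    then have "?r / t * ?q \<le> ?m" by (simp only: distrib_left mult.left_commute)
    then have "(t * e) * (?r / t * ?q) \<le> (t * e) * ?m"
      using e(1) tpos by (intro mult_left_mono) auto
    moreover have "(t * e) * (v / t * q) = v * (e * q)" for v q :: real using tpos by simp
    moreover have "(t * e) * ?m = ?r * t" unfolding mult.assoc e(2) by (rule mult.commute)
    ultimately have "?r * (e * ?q) \<le> ?r * t" by simp
    then have "e * ?q \<le> t" using r by (simp only: mult_le_cancel_left_pos)
    then show False using t(2) by simp
  qed
  \<comment> \<open>On the positive quadrant \<open>f\<close> and \<open>g\<close> act like the old
    coefficients at a point with changed signs, where \<open>\<psi>\<close> is no larger; a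
    vanishing coefficient only deletes a coordinate.\<close>
  define f g where "f = \<bar>e * h1\<bar>" and "g = \<bar>e * h2\<bar>"
  have fg_le: "f * x + g * y \<le> \<psi> (x, y)" if "0 \<le> x" "0 \<le> y" for x y
  proof -
    have "f * x + g * y = e * (h1 * (sgn h1 * x) + h2 * (sgn h2 * y))"
      using e(1) by (simp add: f_def g_def abs_mult abs_sgn[of h1] abs_sgn[of h2] algebra_simps)
    also have "\<dots> \<le> \<psi> (sgn h1 * x, sgn h2 * y)" by (rule le)
    also have "\<dots> = \<psi> (\<bar>sgn h1\<bar> * x, \<bar>sgn h2\<bar> * y)"
      using psi_abs[of "sgn h1 * x" "sgn h2 * y"] that by (simp add: abs_mult)
    also have "\<dots> \<le> \<psi> (x, y)" using that by (intro psi_mono) (auto simp: sgn_if)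
    finally show ?thesis .
  qed
  have "?r = e * h1 * a + e * h2 * b" using e(2) by (simp add: algebra_simps)
  also have "\<dots> \<le> f * a + g * b"
    unfolding f_def g_def using nonneg by (intro add_mono mult_right_mono) auto
  finally have "f * a + g * b = ?r" using fg_le[OF nonneg] by simp
  moreover have "f \<le> 1" "g \<le> 1" using fg_le[of 1 0] fg_le[of 0 1] psi_unit by auto
  moreover have "0 \<le> f" "0 \<le> g" by (simp_all add: f_def g_def)
  ultimately show ?thesis using fg_le by (intro exI[of _ f] exI[of _ g]) simp
qed

text \<open>Both norms lie between the maximum and the sum of the coordinate norms, whence the
  constant 2.\<close>

lemma psi_sum_renorming: "renorming (psi_sum_norm \<psi> :: 'a::banach \<times> 'b::banach \<Rightarrow> real) 2"
proof
  fix p q :: "'a \<times> 'b" and c :: real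
  have "psi_sum_norm \<psi> (p + q) \<le> \<psi> (norm (fst p) + norm (fst q), norm (snd p) + norm (snd q))"
    unfolding psi_sum_norm_def by (intro psi_mono) (simp_all add: norm_triangle_ineq)
  also have "\<dots> \<le> psi_sum_norm \<psi> p + psi_sum_norm \<psi> q"
    unfolding psi_sum_norm_def by (rule psi_triangle)
  finally show "psi_sum_norm \<psi> (p + q) \<le> psi_sum_norm \<psi> p + psi_sum_norm \<psi> q" .
  show "psi_sum_norm \<psi> (c *\<^sub>R p) = \<bar>c\<bar> * psi_sum_norm \<psi> p"
    using psi_scale[of "\<bar>c\<bar>" "norm (fst p)" "norm (snd p)"] by (simp add: psi_sum_norm_def)
  show "norm p \<le> 2 * psi_sum_norm \<psi> p"
    using norm_Pair_le[of "fst p" "snd p"] psi_ge(1)[of "norm (fst p)" "norm (snd p)"]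
      psi_ge(2)[of "norm (snd p)" "norm (fst p)"]
    by (simp add: psi_sum_norm_def)
  show "psi_sum_norm \<psi> p \<le> 2 * norm p"
    using norm_fst_le[of "fst p" "snd p"] norm_snd_le[of "snd p" "fst p"]
      psi_le_sum[of "norm (fst p)" "norm (snd p)"]
    by (simp add: psi_sum_norm_def)
qed simp

end

section \<open>Scalar estimates for the two coordinates\<close>

text \<open>The second coordinate is the one carrying \<open>\<gamma>\<close>. As
  \<open>f1 * \<gamma>1\<close> and \<open>f2 * \<alpha>2\<close> are negligible,
  \<open>f2 * \<gamma>2\<close> must be almost \<open>s\<close> and \<open>f1 * \<eta>1\<close>
  almost \<open>d - s\<close>. So \<open>f2\<close> is almost 1, \<open>f2 * \<eta>2\<close> is
  negligible, and \<open>a\<close>, \<open>\<delta>2\<close>, \<open>\<gamma>2\<close> nearly agree.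
  The summand \<open>d / s\<close> pays for replacing \<open>f2 * a\<close> by
  \<open>a\<close>.\<close>

lemma coordinate_estimate:
  fixes f1 f2 \<alpha>1 \<alpha>2 \<gamma>1 \<gamma>2 \<delta>1 \<delta>2 \<eta>1 \<eta>2 a s d \<epsilon> e :: real
  assumes f: "0 \<le> f1" "0 \<le> f2" "f2 \<le> 1"
    and \<delta>: "d - \<epsilon> \<le> f1 * \<delta>1 + f2 * \<delta>2" and \<eta>: "f1 * \<eta>1 + f2 * \<eta>2 \<le> d - s"
    and \<gamma>: "f1 * \<gamma>1 + f2 * \<gamma>2 \<le> s" "\<gamma>2 \<le> s" and nonneg: "0 \<le> \<alpha>1" "0 \<le> \<alpha>2" "0 \<le> \<gamma>1" "0 \<le> \<gamma>2"
    and le: "\<alpha>1 \<le> \<eta>1" "\<alpha>2 \<le> \<eta>2" "\<delta>1 \<le> \<alpha>1 + \<gamma>1" "\<delta>2 \<le> \<alpha>2 + \<gamma>2" "\<bar>a - \<delta>2\<bar> \<le> \<eta>2"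
    and a: "0 \<le> a" "a \<le> d" and small: "f1 * \<gamma>1 + f2 * \<alpha>2 \<le> e" and pos: "0 < s" "s < d" "0 < \<epsilon>"
      "0 < e"
  shows "\<bar>a - s\<bar> \<le> (\<epsilon> + e) * (2 + d / s)"
proof -
  have m: "f1 * \<alpha>1 \<le> f1 * \<eta>1" "f2 * \<alpha>2 \<le> f2 * \<eta>2" "f1 * \<delta>1 \<le> f1 * \<alpha>1 + f1 * \<gamma>1"
    "f2 * \<delta>2 \<le> f2 * \<alpha>2 + f2 * \<gamma>2" "f2 * a \<le> f2 * \<delta>2 + f2 * \<eta>2" "f2 * \<delta>2 \<le> f2 * a + f2 * \<eta>2"
    "f2 * \<gamma>2 \<le> f2 * s"
    using f le \<gamma>(2) by (auto simp flip: distrib_left intro!: mult_left_mono)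
  have n: "0 \<le> f1 * \<alpha>1" "0 \<le> f2 * \<alpha>2" "0 \<le> f1 * \<gamma>1" "0 \<le> f2 * \<gamma>2" using f nonneg by auto
  have \<eta>2: "f2 * \<eta>2 \<le> e + \<epsilon>" and fa: "\<bar>f2 * a - s\<bar> \<le> 2 * e + 2 * \<epsilon>" and f2: "(1 - f2) * s \<le> e + \<epsilon>"
    using m n small \<delta> \<eta> \<gamma>(1) by (auto simp: left_diff_distrib abs_le_iff)
  have "(1 - f2) * a \<le> (1 - f2) * d" using f a by (intro mult_left_mono) auto
  also have "\<dots> = ((1 - f2) * s) * (d / s)" using pos by simp
  also have "\<dots> \<le> (e + \<epsilon>) * (d / s)" using f2 pos by (intro mult_right_mono) auto
  finally have 1: "a - f2 * a \<le> (e + \<epsilon>) * (d / s)" by (simp add: left_diff_distrib)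
  have 2: "f2 * a \<le> a" using f a by (simp add: mult_left_le_one_le)
  have 3: "0 \<le> (e + \<epsilon>) * (d / s)" using pos by (intro mult_nonneg_nonneg) auto
  have "(\<epsilon> + e) * (2 + d / s) = 2 * e + 2 * \<epsilon> + (e + \<epsilon>) * (d / s)" by (simp add: algebra_simps)
  then show ?thesis using fa 1 2 3 by linarith
qed

text \<open>Almost all of the norm of \<open>\<delta>\<close> must come from \<open>\<alpha>\<close> and \<open>\<gamma>\<close> simultaneously, and by
  nonsquareness no coordinate can contribute to both. Hence one coordinate carries \<open>\<gamma>\<close>, which
  forces the corresponding \<open>a\<^sub>i\<close> to be close to \<open>s\<close>.\<close>

lemma (in absolute_norm) dichotomy:
  fixes \<alpha>1 \<alpha>2 \<gamma>1 \<gamma>2 \<delta>1 \<delta>2 \<eta>1 \<eta>2 a1 a2 s d \<epsilon> \<kappa> :: real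
  assumes \<delta>: "d - \<epsilon> \<le> \<psi> (\<delta>1, \<delta>2)" and \<eta>: "\<psi> (\<eta>1, \<eta>2) \<le> d - s" and \<gamma>: "\<psi> (\<gamma>1, \<gamma>2) \<le> s"
    and nonneg: "0 \<le> \<alpha>1" "0 \<le> \<alpha>2" "0 \<le> \<gamma>1" "0 \<le> \<gamma>2" "0 \<le> \<delta>1" "0 \<le> \<delta>2"
    and le: "\<alpha>1 \<le> \<eta>1" "\<alpha>2 \<le> \<eta>2" "\<bar>a1 - \<delta>1\<bar> \<le> \<eta>1" "\<bar>a2 - \<delta>2\<bar> \<le> \<eta>2"
    and ns: "\<delta>1 \<le> \<alpha>1 + \<gamma>1 - \<kappa> * min \<alpha>1 \<gamma>1" "\<delta>2 \<le> \<alpha>2 + \<gamma>2 - \<kappa> * min \<alpha>2 \<gamma>2"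
    and a: "0 \<le> a1" "a1 \<le> d" "0 \<le> a2" "a2 \<le> d"
    and pos: "0 < s" "s < d" "0 < \<epsilon>" "0 < \<kappa>"
    and small: "\<epsilon> + \<epsilon> / \<kappa> < s" "\<epsilon> + \<epsilon> / \<kappa> < d - s"
  shows "\<bar>a1 - s\<bar> \<le> (\<epsilon> + \<epsilon> / \<kappa>) * (2 + d / s) \<or> \<bar>a2 - s\<bar> \<le> (\<epsilon> + \<epsilon> / \<kappa>) * (2 + d / s)"
proof -
  define e where "e = \<epsilon> / \<kappa>"
  have e: "0 < e" "\<kappa> * e = \<epsilon>" using pos by (simp_all add: e_def)
  obtain f1 f2 where f: "0 \<le> f1" "f1 \<le> 1" "0 \<le> f2" "f2 \<le> 1" "f1 * \<delta>1 + f2 * \<delta>2 = \<psi> (\<delta>1, \<delta>2)"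
    and fle: "\<And>x y. 0 \<le> x \<Longrightarrow> 0 \<le> y \<Longrightarrow> f1 * x + f2 * y \<le> \<psi> (x, y)"
    using support_functional[OF nonneg(5,6)] by metis
  have f\<delta>: "d - \<epsilon> \<le> f1 * \<delta>1 + f2 * \<delta>2" using f(5) \<delta> by simp
  have f\<eta>: "f1 * \<eta>1 + f2 * \<eta>2 \<le> d - s" using fle[of \<eta>1 \<eta>2] \<eta> nonneg le by simp
  have f\<gamma>: "f1 * \<gamma>1 + f2 * \<gamma>2 \<le> s" using fle[of \<gamma>1 \<gamma>2] \<gamma> nonneg by simp
  have \<gamma>s: "\<gamma>1 \<le> s" "\<gamma>2 \<le> s" using psi_ge(1)[of \<gamma>1 \<gamma>2] psi_ge(2)[of \<gamma>2 \<gamma>1] \<gamma> by auto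
  have f\<alpha>: "f1 * \<alpha>1 \<le> f1 * \<eta>1" "f2 * \<alpha>2 \<le> f2 * \<eta>2" using f le by (auto intro: mult_left_mono)
  have ns': "\<delta>1 \<le> \<alpha>1 + \<gamma>1" "\<delta>2 \<le> \<alpha>2 + \<gamma>2" using ns nonneg pos(4)
    by (smt (verit) mult_nonneg_nonneg)+
  let ?m = "f1 * min \<alpha>1 \<gamma>1 + f2 * min \<alpha>2 \<gamma>2"
  have "f1 * \<delta>1 \<le> f1 * (\<alpha>1 + \<gamma>1 - \<kappa> * min \<alpha>1 \<gamma>1)" "f2 * \<delta>2 \<le> f2 * (\<alpha>2 + \<gamma>2 - \<kappa> * min \<alpha>2 \<gamma>2)"
    using f ns by (auto intro: mult_left_mono)
  \<comment> \<open>The bounds \<open>d - s\<close> and \<open>s\<close> for the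
    \<open>\<alpha>\<close> and \<open>\<gamma>\<close> parts add up to \<open>d\<close>, while the
    left side is at least \<open>d - \<epsilon>\<close>; so the nonsquareness defect is at most
    \<open>\<epsilon>\<close>.\<close>
  then have "\<kappa> * ?m \<le> \<kappa> * e"
    using f\<delta> f\<eta> f\<gamma> f\<alpha> e(2) by (simp add: algebra_simps)
  then have m: "?m \<le> e" using pos(4) by simp
  have f\<delta>': "f1 * \<delta>1 \<le> f1 * \<alpha>1 + f1 * \<gamma>1" "f2 * \<delta>2 \<le> f2 * \<alpha>2 + f2 * \<gamma>2"
    using f ns' by (auto simp flip: distrib_left intro!: mult_left_mono)
  \<comment> \<open>The cases record the smaller of \<open>\<alpha>\<close> and
    \<open>\<gamma>\<close> in each coordinate. If it is the same kind in both, that kind is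
    negligible in total, and the other alone cannot reach \<open>d - \<epsilon>\<close>.\<close>
  consider "\<alpha>1 \<le> \<gamma>1" "\<alpha>2 \<le> \<gamma>2" | "\<gamma>1 \<le> \<alpha>1" "\<gamma>2 \<le> \<alpha>2" | "\<gamma>1 \<le> \<alpha>1" "\<alpha>2 \<le> \<gamma>2" | "\<alpha>1 \<le> \<gamma>1" "\<gamma>2 \<le> \<alpha>2"
    by linarith
  then show ?thesis
  proof cases
    case 1
    then have "f1 * \<alpha>1 + f2 * \<alpha>2 \<le> e" using m by (simp add: min_def)
    then have False using f\<delta> f\<delta>' f\<gamma> small e_def by linarith
    then show ?thesis ..
  next
    case 2
    then have "f1 * \<gamma>1 + f2 * \<gamma>2 \<le> e" using m by (simp add: min_absorb2)
    then have False using f\<delta> f\<delta>' f\<alpha> f\<eta> small e_def by linarith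
    then show ?thesis ..
  next
    case 3
    then have "f1 * \<gamma>1 + f2 * \<alpha>2 \<le> e" using m by (simp add: min_absorb1 min_absorb2)
    then have "\<bar>a2 - s\<bar> \<le> (\<epsilon> + e) * (2 + d / s)"
      using f(1,3,4) f\<delta> f\<eta> f\<gamma> \<gamma>s nonneg le ns' a pos e(1)
      by (intro coordinate_estimate[of f1 f2 d \<epsilon> \<delta>1 \<delta>2 \<eta>1 \<eta>2 s \<gamma>1 \<gamma>2 \<alpha>1 \<alpha>2 a2 e]) auto
    then show ?thesis by (simp add: e_def)
  next
    case 4
    then have "f2 * \<gamma>2 + f1 * \<alpha>1 \<le> e" using m by (simp add: min_absorb1 min_absorb2)
    then have "\<bar>a1 - s\<bar> \<le> (\<epsilon> + e) * (2 + d / s)"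
      using f(1,2,3) f\<delta> f\<eta> f\<gamma> \<gamma>s nonneg le ns' a pos e(1)
      by (intro coordinate_estimate[of f2 f1 d \<epsilon> \<delta>2 \<delta>1 \<eta>2 \<eta>1 s \<gamma>2 \<gamma>1 \<alpha>2 \<alpha>1 a1 e]) auto
    then show ?thesis by (simp add: e_def)
  qed
qed

text \<open>The order of choices matters: \<open>x\<close> and \<open>w\<close> determine
  \<open>a1\<close> and \<open>a2\<close>, then \<open>s\<close> avoids both, then
  \<open>\<epsilon>\<close> is made small relative to the gaps, and only then is \<open>z\<close>
  constructed.\<close>

lemma (in absolute_norm) no_positive_diameter:
  fixes T :: "'a::banach \<times> 'b::banach \<Rightarrow> 'a \<times> 'b"
  assumes uns: "uniformly_nonsquare TYPE('a)" "uniformly_nonsquare TYPE('b)"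
    and loc: "nonexpansive_minimal (psi_sum_norm \<psi>) 2 T K d"
  shows False
proof -
  let ?N = "psi_sum_norm \<psi> :: 'a \<times> 'b \<Rightarrow> real"
  interpret nonexpansive_minimal ?N 2 T K d by (rule loc)
  obtain \<kappa>1 where \<kappa>1: "0 < \<kappa>1" "\<kappa>1 \<le> 1"
    "\<And>x y::'a. min (norm (x + y)) (norm (x - y)) \<le> norm x + norm y - \<kappa>1 * min (norm x) (norm y)"
    using uniformly_nonsquareE[OF uns(1)] by metis
  obtain \<kappa>2 where \<kappa>2: "0 < \<kappa>2" "\<kappa>2 \<le> 1"
    "\<And>x y::'b. min (norm (x + y)) (norm (x - y)) \<le> norm x + norm y - \<kappa>2 * min (norm x) (norm y)"
    using uniformly_nonsquareE[OF uns(2)] by metis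
  define \<kappa> where "\<kappa> = min \<kappa>1 \<kappa>2"
  have \<kappa>: "0 < \<kappa>" using \<kappa>1(1) \<kappa>2(1) by (simp add: \<kappa>_def)
  have ns1: "min (norm (x + y)) (norm (x - y)) \<le> norm x + norm y - \<kappa> * min (norm x) (norm y)"
    for x y :: 'a
  proof -
    have "\<kappa> * min (norm x) (norm y) \<le> \<kappa>1 * min (norm x) (norm y)"
      by (intro mult_right_mono) (auto simp: \<kappa>_def)
    then show ?thesis using \<kappa>1(3)[of x y] by linarith
  qed
  have ns2: "min (norm (x + y)) (norm (x - y)) \<le> norm x + norm y - \<kappa> * min (norm x) (norm y)"
    for x y :: 'b
  proof -
    have "\<kappa> * min (norm x) (norm y) \<le> \<kappa>2 * min (norm x) (norm y)"
      by (intro mult_right_mono) (auto simp: \<kappa>_def)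
    then show ?thesis using \<kappa>2(3)[of x y] by linarith
  qed
  obtain M where M: "\<forall>p\<in>K. norm p \<le> M" using bounded unfolding bounded_iff by auto
  have M12: "norm (fst p) \<le> M" "norm (snd p) \<le> M" if "p \<in> K" for p
    using bspec[OF M that] norm_fst_le[of "fst p" "snd p"] norm_snd_le[of "snd p" "fst p"] by auto
  obtain x where x: "\<And>n. x n \<in> K" "(\<lambda>n. ?N (T (x n) - x n)) \<longlonglongrightarrow> 0"
    by (rule approximate_fixed_points) (rule that)
  obtain U where U: "U \<le> sequentially" "ultra U" by (rule ultra_exists[OF sequentially_bot])
  have nb: "U \<noteq> bot" using U(2) by (simp add: ultra_def)
  have null: "((\<lambda>n. ?N (T (x n) - x n)) \<longlongrightarrow> 0) U" by (rule tendsto_mono[OF U(1) x(2)])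
  have ev: "\<forall>\<^sub>F n in U. norm (z n) \<le> M" if "\<And>n. z n \<in> K" for z
    using M that by simp
  obtain w where w: "weak_lim U x w" by (rule weak_lim_exists[OF cc nb ev[of x, OF x(1)]])
  have wK: "w \<in> K" by (rule weak_limD[OF w K(2,3)]) (simp add: x(1))
  define a1 a2 where "a1 = Lim U (\<lambda>n. norm (fst (x n) - fst w))"
    and "a2 = Lim U (\<lambda>n. norm (snd (x n) - snd w))"
  have lim1: "((\<lambda>n. norm (fst (u n) - fst (v n))) \<longlongrightarrow> Lim U (\<lambda>n. norm (fst (u n) - fst (v n)))) U"
    and lim2: "((\<lambda>n. norm (snd (u n) - snd (v n))) \<longlongrightarrow> Lim U (\<lambda>n. norm (snd (u n) - snd (v n)))) U"
    if "\<And>n. u n \<in> K" "\<And>n. v n \<in> K" for u v :: "nat \<Rightarrow> 'a \<times> 'b"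
    by (rule ultra_tendsto_norm_diff[OF U(2), of _ M _ M]; simp add: M12 that)+
  have a: "0 \<le> a1" "a1 \<le> d" "0 \<le> a2" "a2 \<le> d"
  proof -
    have 1: "((\<lambda>n. norm (fst (x n) - fst w)) \<longlongrightarrow> a1) U"
      unfolding a1_def by (rule lim1[of x "\<lambda>_. w"]) (simp_all add: x(1) wK)
    have 2: "((\<lambda>n. norm (snd (x n) - snd w)) \<longlongrightarrow> a2) U"
      unfolding a2_def by (rule lim2[of x "\<lambda>_. w"]) (simp_all add: x(1) wK)
    have le: "norm (fst (x n) - fst w) \<le> d" "norm (snd (x n) - snd w) \<le> d" for n
      using diam[OF x(1)[of n] wK]
        psi_ge(1)[of "norm (fst (x n) - fst w)" "norm (snd (x n) - snd w)"]
        psi_ge(2)[of "norm (snd (x n) - snd w)" "norm (fst (x n) - fst w)"]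
      by (auto simp: psi_sum_norm_def)
    show "0 \<le> a1" by (rule tendsto_lowerbound[OF 1 _ nb]) simp
    show "0 \<le> a2" by (rule tendsto_lowerbound[OF 2 _ nb]) simp
    show "a1 \<le> d" by (rule tendsto_upperbound[OF 1 _ nb]) (simp add: le)
    show "a2 \<le> d" by (rule tendsto_upperbound[OF 2 _ nb]) (simp add: le)
  qed
  obtain s where s: "0 < s" "s < d" "s \<noteq> a1" "s \<noteq> a2"
  proof -
    have "infinite ({0<..<d} - {a1, a2})" using diam_pos by (simp add: infinite_Ioo)
    then obtain s where "s \<in> {0<..<d} - {a1, a2}" by (metis finite.emptyI ex_in_conv)
    then show thesis by (intro that[of s]) auto
  qed
  \<comment> \<open>The total error must be below \<open>s\<close> and \<open>d - s\<close> for the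
    mixed cases, and below both gaps after multiplication by \<open>2 + d / s\<close>; halving makes
    this strict.\<close>
  define E where "E = min (min s (d - s)) (min \<bar>a1 - s\<bar> \<bar>a2 - s\<bar> / (2 + d / s)) / 2"
  have ds: "0 < 2 + d / s" using s diam_pos by (simp add: add_pos_nonneg)
  have E: "0 < E" "E < s" "E < d - s" using s ds by (auto simp: E_def)
  have E_far: "E * (2 + d / s) < \<bar>a1 - s\<bar>" "E * (2 + d / s) < \<bar>a2 - s\<bar>"
  proof -
    let ?m = "min \<bar>a1 - s\<bar> \<bar>a2 - s\<bar>"
    have m: "0 < ?m" using s by simp
    have "E \<le> ?m / (2 + d / s) / 2" unfolding E_def by (intro divide_right_mono min.cobounded2) simp
    then have "E * (2 + d / s) \<le> ?m / (2 + d / s) / 2 * (2 + d / s)"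
      using ds by (intro mult_right_mono) auto
    also have "\<dots> = ?m / 2"
    proof -
      have "m / L / 2 * L = m / 2" if "0 < L" for m L :: real using that by simp
      then show ?thesis using ds by blast
    qed
    also have "\<dots> < ?m"
    proof -
      have "m / 2 < m" if "0 < m" for m :: real using that by simp
      then show ?thesis using m by blast
    qed
    finally have "E * (2 + d / s) < ?m" .
    then show "E * (2 + d / s) < \<bar>a1 - s\<bar>" "E * (2 + d / s) < \<bar>a2 - s\<bar>" by auto
  qed
  \<comment> \<open>Solves \<open>\<epsilon> + \<epsilon> / \<kappa> = E\<close>: the
    Goebel-Karlovitz error plus the error from dividing the defect by
    \<open>\<kappa>\<close>.\<close>
  define \<epsilon> where "\<epsilon> = E / (1 + 1 / \<kappa>)"
  have pos: "0 < 1 + 1 / \<kappa>" using \<kappa> by (simp add: add_pos_pos)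
  have \<epsilon>: "0 < \<epsilon>" "\<epsilon> + \<epsilon> / \<kappa> = E"
  proof -
    show "0 < \<epsilon>" using E(1) pos by (simp add: \<epsilon>_def)
    have "\<epsilon> + \<epsilon> / \<kappa> = \<epsilon> * (1 + 1 / \<kappa>)" by (simp add: algebra_simps)
    then show "\<epsilon> + \<epsilon> / \<kappa> = E" using pos by (simp add: \<epsilon>_def)
  qed
  obtain z C where z: "\<And>n. z n \<in> K" "\<And>n m. ?N (z n - z m) \<le> s" "\<And>n. d - \<epsilon> \<le> ?N (z n - w)"
    "\<And>n. ?N (z n - x n) \<le> d - s + C * ?N (T (x n) - x n)"
    by (rule perturbed_fixed_points[OF x(1) wK s(1,2) \<epsilon>(1)]) (rule that)
  obtain v where v: "weak_lim U (\<lambda>n. (x n, z n)) (w, v)"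
    by (rule weak_lim_Pair[OF cc nb w ev[of z, OF z(1)]])
  have "bounded_linear (\<lambda>p :: ('a \<times> 'b) \<times> ('a \<times> 'b). (fst (fst p), fst (snd p)))"
    by (intro bounded_linear_Pair bounded_linear_compose[OF bounded_linear_fst bounded_linear_fst]
        bounded_linear_compose[OF bounded_linear_fst bounded_linear_snd])
  from weak_lim_linear[OF v this]
  have v1: "weak_lim U (\<lambda>n. (fst (x n), fst (z n))) (fst w, fst v)" by simp
  have "bounded_linear (\<lambda>p :: ('a \<times> 'b) \<times> ('a \<times> 'b). (snd (fst p), snd (snd p)))"
    by (intro bounded_linear_Pair bounded_linear_compose[OF bounded_linear_snd bounded_linear_fst]
        bounded_linear_compose[OF bounded_linear_snd bounded_linear_snd])
  from weak_lim_linear[OF v this]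
  have v2: "weak_lim U (\<lambda>n. (snd (x n), snd (z n))) (snd w, snd v)" by simp
  from weak_lim_linear[OF v1 bounded_linear_snd]
  have v1': "weak_lim U (\<lambda>n. fst (z n)) (fst v)" by simp
  from weak_lim_linear[OF v2 bounded_linear_snd]
  have v2': "weak_lim U (\<lambda>n. snd (z n)) (snd v)" by simp
  \<comment> \<open>The limits in \<open>m\<close> and \<open>n\<close> are taken one after the
    other, and \<open>\<psi> \<le> s\<close> has to be carried through each of them.\<close>
  define g1 g2 where "g1 n = Lim U (\<lambda>m. norm (fst (z n) - fst (z m)))"
    and "g2 n = Lim U (\<lambda>m. norm (snd (z n) - snd (z m)))" for n
  define \<gamma>1 \<gamma>2 where "\<gamma>1 = Lim U g1" and "\<gamma>2 = Lim U g2"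
  define \<delta>1 \<delta>2 where "\<delta>1 = Lim U (\<lambda>n. norm (fst (z n) - fst w))"
    and "\<delta>2 = Lim U (\<lambda>n. norm (snd (z n) - snd w))"
  define \<eta>1 \<eta>2 where "\<eta>1 = Lim U (\<lambda>n. norm (fst (z n) - fst (x n)))"
    and "\<eta>2 = Lim U (\<lambda>n. norm (snd (z n) - snd (x n)))"
  have g_lim: "((\<lambda>m. norm (fst (z n) - fst (z m))) \<longlongrightarrow> g1 n) U"
    "((\<lambda>m. norm (snd (z n) - snd (z m))) \<longlongrightarrow> g2 n) U" for n
    unfolding g1_def g2_def using lim1[of "\<lambda>_. z n" z] lim2[of "\<lambda>_. z n" z] z(1) by simp_all
  have \<delta>_lim: "((\<lambda>n. norm (fst (z n) - fst w)) \<longlongrightarrow> \<delta>1) U" "((\<lambda>n. norm (snd (z n) - snd w)) \<longlongrightarrow> \<delta>2) U"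
    unfolding \<delta>1_def \<delta>2_def using lim1[of z "\<lambda>_. w"] lim2[of z "\<lambda>_. w"] z(1) wK by simp_all
  have \<eta>_lim: "((\<lambda>n. norm (fst (z n) - fst (x n))) \<longlongrightarrow> \<eta>1) U"
    "((\<lambda>n. norm (snd (z n) - snd (x n))) \<longlongrightarrow> \<eta>2) U"
    unfolding \<eta>1_def \<eta>2_def using lim1[of z x] lim2[of z x] z(1) x(1) by simp_all
  have g_le: "\<psi> (g1 n, g2 n) \<le> s" for n
    by (rule tendsto_upperbound[OF psi_tendsto[OF g_lim] _ nb])
      (use z(2)[of n] in \<open>simp add: psi_sum_norm_def\<close>)
  have g_nonneg: "0 \<le> g1 n" "0 \<le> g2 n" for n
    by (rule tendsto_lowerbound[OF g_lim(1) _ nb], simp)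
      (rule tendsto_lowerbound[OF g_lim(2) _ nb], simp)
  have g_s: "\<bar>g1 n\<bar> \<le> s" "\<bar>g2 n\<bar> \<le> s" for n
    using psi_ge(1)[of "g1 n" "g2 n"] psi_ge(2)[of "g2 n" "g1 n"] g_le[of n] by linarith+
  have \<gamma>_lim: "(g1 \<longlongrightarrow> \<gamma>1) U" "(g2 \<longlongrightarrow> \<gamma>2) U"
    unfolding \<gamma>1_def \<gamma>2_def by (rule ultra_tendsto_Lim[OF U(2), of _ s]; simp add: g_s)+
  have \<gamma>: "\<psi> (\<gamma>1, \<gamma>2) \<le> s"
    by (rule tendsto_upperbound[OF psi_tendsto[OF \<gamma>_lim] _ nb]) (simp add: g_le)
  have \<delta>: "d - \<epsilon> \<le> \<psi> (\<delta>1, \<delta>2)"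
    by (rule tendsto_lowerbound[OF psi_tendsto[OF \<delta>_lim] _ nb])
      (use z(3) in \<open>simp add: psi_sum_norm_def\<close>)
  have \<eta>: "\<psi> (\<eta>1, \<eta>2) \<le> d - s"
  proof (rule tendsto_le[OF nb _ psi_tendsto[OF \<eta>_lim]])
    have "((\<lambda>n. d - s + C * ?N (T (x n) - x n)) \<longlongrightarrow> d - s + C * 0) U"
      by (intro tendsto_add tendsto_const tendsto_mult null)
    then show "((\<lambda>n. d - s + C * ?N (T (x n) - x n)) \<longlongrightarrow> d - s) U" by simp
    have "\<psi> (norm (fst (z n) - fst (x n)), norm (snd (z n) - snd (x n)))
      \<le> d - s + C * ?N (T (x n) - x n)" for n
      using z(4)[of n] by (simp add: psi_sum_norm_def)
    then show "\<forall>\<^sub>F n in U. \<psi> (norm (fst (z n) - fst (x n)), norm (snd (z n) - snd (x n)))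
      \<le> d - s + C * ?N (T (x n) - x n)"
      by simp
  qed
  have bds: "norm (fst (z n)) \<le> M" "norm (snd (z n)) \<le> M" "norm (fst (x n)) \<le> M"
    "norm (snd (x n)) \<le> M" for n
    by (simp_all add: M12 z(1) x(1))
  have "\<bar>a1 - s\<bar> \<le> (\<epsilon> + \<epsilon> / \<kappa>) * (2 + d / s) \<or> \<bar>a2 - s\<bar> \<le> (\<epsilon> + \<epsilon> / \<kappa>) * (2 + d / s)"
  proof (rule dichotomy[OF \<delta> \<eta> \<gamma>])
    show "0 \<le> norm (fst v - fst w)" "0 \<le> norm (snd v - snd w)" by simp_all
    show "0 \<le> \<gamma>1" by (rule tendsto_lowerbound[OF \<gamma>_lim(1) _ nb]) (simp add: g_nonneg)
    show "0 \<le> \<gamma>2" by (rule tendsto_lowerbound[OF \<gamma>_lim(2) _ nb]) (simp add: g_nonneg)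
    show "0 \<le> \<delta>1" by (rule tendsto_lowerbound[OF \<delta>_lim(1) _ nb]) simp
    show "0 \<le> \<delta>2" by (rule tendsto_lowerbound[OF \<delta>_lim(2) _ nb]) simp
    show "norm (fst v - fst w) \<le> \<eta>1" "\<bar>a1 - \<delta>1\<bar> \<le> \<eta>1"
      unfolding \<eta>1_def \<delta>1_def a1_def by (rule weak_lim_comparison[OF U(2) v1 bds(3,1)])+
    show "norm (snd v - snd w) \<le> \<eta>2" "\<bar>a2 - \<delta>2\<bar> \<le> \<eta>2"
      unfolding \<eta>2_def \<delta>2_def a2_def by (rule weak_lim_comparison[OF U(2) v2 bds(4,2)])+
    show "\<delta>1 \<le> norm (fst v - fst w) + \<gamma>1 - \<kappa> * min (norm (fst v - fst w)) \<gamma>1"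
      unfolding \<delta>1_def \<gamma>1_def g1_def by (rule nonsquare_weak_lim[OF U(2) v1' bds(1) \<kappa> ns1])
    show "\<delta>2 \<le> norm (snd v - snd w) + \<gamma>2 - \<kappa> * min (norm (snd v - snd w)) \<gamma>2"
      unfolding \<delta>2_def \<gamma>2_def g2_def by (rule nonsquare_weak_lim[OF U(2) v2' bds(2) \<kappa> ns2])
  qed (use a s \<epsilon> \<kappa> E in auto)
  then show False using E_far unfolding \<epsilon>(2) by linarith
qed

text \<open>The set \<open>C\<close> is described through \<open>psi_sum_norm\<close> only;
  equivalence of norms makes it closed and bounded in the product, where convex compactness supplies
  a minimal invariant set. If its diameter \<open>d\<close> is not positive, it is a single point,
  which \<open>T\<close> fixes.\<close>

theorem theorem3p7:
  fixes \<psi> :: "real \<times> real \<Rightarrow> real"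
  assumes "uniformly_nonsquare TYPE('a::banach)"
    and "uniformly_nonsquare TYPE('b::banach)"
    and "absolute_normalized_norm \<psi>"
  shows "fixed_point_property (psi_sum_norm \<psi> :: 'a \<times> 'b \<Rightarrow> real)"
  unfolding fixed_point_property_def
proof (intro allI impI, elim conjE exE)
  let ?N = "psi_sum_norm \<psi> :: 'a \<times> 'b \<Rightarrow> real"
  interpret absolute_norm \<psi> by standard (rule assms(3))
  interpret renorming ?N 2 by (rule psi_sum_renorming)
  fix C T M
  assume C: "C \<noteq> {}" "convex C" and M: "\<forall>x\<in>C. ?N x \<le> M"
    and cl: "\<forall>s x. (\<forall>n. s n \<in> C) \<and> ((\<lambda>n. ?N (s n - x)) \<longlonglongrightarrow> 0) \<longrightarrow> x \<in> C"
    and T: "T ` C \<subseteq> C" and nonexp: "\<forall>x\<in>C. \<forall>y\<in>C. ?N (T x - T y) \<le> ?N (x - y)"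
  have cc: "convex_compact TYPE('a \<times> 'b)"
    by (intro convex_compact_prod uniformly_nonsquare_convex_compact assms)
  have closed: "closed C"
    unfolding closed_sequential_limits
  proof (intro allI impI, elim conjE)
    fix s l assume s: "\<forall>n. s n \<in> C" "s \<longlonglongrightarrow> l"
    have "(\<lambda>n. ?N (s n - l)) \<longlonglongrightarrow> 0"
    proof (rule Lim_null_comparison)
      show "\<forall>\<^sub>F n in sequentially. norm (?N (s n - l)) \<le> 2 * norm (s n - l)"
        using N_upper N_nonneg by simp
      have "(\<lambda>n. 2 * norm (s n - l)) \<longlonglongrightarrow> 2 * norm (l - l)" by (intro tendsto_intros s(2))
      then show "(\<lambda>n. 2 * norm (s n - l)) \<longlonglongrightarrow> 0" by simp
    qed
    with s(1) have "(\<forall>n. s n \<in> C) \<and> (\<lambda>n. ?N (s n - l)) \<longlonglongrightarrow> 0" by (rule conjI)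
    then show "l \<in> C" by (rule mp[OF spec[OF spec[OF cl, of s], of l]])
  qed
  have bd: "bounded C"
    unfolding bounded_iff
  proof (intro exI ballI)
    show "norm x \<le> 2 * M" if "x \<in> C" for x using N_lower[of x] bspec[OF M that] by linarith
  qed
  have inv: "invariant_set T C" using C T closed by (simp add: invariant_set_def)
  obtain K where K: "K \<subseteq> C" "minimal_invariant T K" by (rule minimal_invariant_exists[OF cc inv bd])
  have Kinv: "K \<noteq> {}" "T ` K \<subseteq> K"
    using K(2) by (simp_all add: minimal_invariant_def invariant_set_def)
  let ?D = "{?N (x - y) | x y. x \<in> K \<and> y \<in> K}"
  have bdd: "bdd_above ?D"
  proof (rule bdd_aboveI[of _ "2 * M"])
    fix r assume "r \<in> ?D"
    then obtain x y where r: "r = ?N (x - y)" "x \<in> K" "y \<in> K" by auto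
    have "?N x \<le> M" "?N y \<le> M" using M r K(1) by auto
    then show "r \<le> 2 * M" using N_triangle[of x "- y"] r(1) by simp
  qed
  define d where "d = Sup ?D"
  have D: "?N (x - y) \<in> ?D" if "x \<in> K" "y \<in> K" for x y
    using that by (intro CollectI exI[of _ x] exI[of _ y]) simp
  have diam: "?N (x - y) \<le> d" if "x \<in> K" "y \<in> K" for x y
    unfolding d_def by (rule cSup_upper[OF D[OF that] bdd])
  have least: "d \<le> r" if r: "\<And>x y. x \<in> K \<Longrightarrow> y \<in> K \<Longrightarrow> ?N (x - y) \<le> r" for r
    unfolding d_def
  proof (rule cSup_least)
    obtain x where "x \<in> K" using Kinv(1) by auto
    then show "?D \<noteq> {}" using D[of x x] by (metis empty_iff)
    show "t \<le> r" if "t \<in> ?D" for t using that by (elim CollectE exE conjE) (simp only: r)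
  qed
  show "\<exists>x\<in>C. T x = x"
  proof (cases "0 < d")
    case True
    have "nonexpansive_minimal ?N 2 T K d"
    proof unfold_locales
      show "?N (T x - T y) \<le> ?N (x - y)" if "x \<in> K" "y \<in> K" for x y
        by (rule bspec[OF bspec[OF nonexp subsetD[OF K(1) that(1)]] subsetD[OF K(1) that(2)]])
      show "d \<le> r" if "\<And>x y. x \<in> K \<Longrightarrow> y \<in> K \<Longrightarrow> ?N (x - y) \<le> r" for r
        by (rule least) (rule that)
    qed (fact cc K(2) bounded_subset[OF bd K(1)] diam True)+
    then show ?thesis using no_positive_diameter[OF assms(1,2)] by blast
  next
    case False
    obtain x where x: "x \<in> K" using Kinv(1) by auto
    then have "T x \<in> K" using Kinv(2) by auto
    then have "?N (T x - x) \<le> 0" using diam[of "T x" x] x False by simp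
    then have "norm (T x - x) \<le> 0" using N_lower[of "T x - x"] by linarith
    then show ?thesis using x K(1) by (intro bexI[of _ x]) auto
  qed
qed

end
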